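(* Let $k,d\geq 2$ be integers, and let $T_{k+1}(d)$ be the symmetric tree of diameter $d$ whose non-leaf vertices all have degree $k+1$. If $d$ is even, then $$hc(T_{k+1}(d))=\frac{(k+1)^2}{(k-1)^2}\left(k^{\frac d2}-1\right)\left[\left(k^{\frac d2}-1\right)+\frac{1}{k+1}\bigl(2-(k-1)d\bigr)\right]-\frac{k+1}{k-1}d+1,$$ and if $d$ is odd, then $$hc(T_{k+1}(d))=\frac{4k}{(k-1)^2}\left(k^{\frac{d-1}{2}}-1\right)\left[k\left(k^{\frac{d-1}{2}}-1\right)+1\right]+\frac{2k}{k-1}(2-d)k^{\frac{d-1}{2}}-\frac{2k}{k-1}.$$
   Context: For a connected graph $G$ of order $n$ (finite, simple), $D(u,v)$ denotes the detour distance between vertices $u,v$, i.e. the length of a longest $u,v$-path in $G$ (for a tree this is the ordinary distance). A hamiltonian coloring of $G$ is a map $c: V(G)\to\{0,1,2,\dots\}$ such that $D(u,v)+|c(u)-c(v)|\geq n-1$ for every two distinct vertices $u,v$. The value $hc(c)$ is the maximum color assigned by $c$, and the hamiltonian chromatic number $hc(G)$ is the minimum of $hc(c)$ over all hamiltonian colorings $c$ of $G$ (note that the color $0$ is allowed). A symmetric tree is a tree in which all vertices other than leaves (degree-one vertices) have the same degree and all leaves have the same eccentricity. $T_{k+1}(d)$ denotes the symmetric tree with diameter $d$ and non-leaf vertices of degree $k+1$. *)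

theory Defs
  imports Complex_Main "Graph_Theory.Graph_Theory"
begin

text \<open>
  Finite simple graphs are rendered by the library locale \<^locale>\<open>graph\<close>: finite, loop-free
  symmetric digraphs without parallel arcs, so that an edge is a pair of opposite arcs. Paths are
  \<open>pre_digraph.apath\<close> (pairwise distinct vertices), given by their lists of arcs; the length of a
  path is the length of that list.
\<close>

text \<open>
  The set in \<open>detour_distance\<close> is finite in a finite digraph, and nonempty for vertices of a
  connected graph.
\<close>

definition detour_distance :: "('a, 'b) pre_digraph \<Rightarrow> 'a \<Rightarrow> 'a \<Rightarrow> nat" where
  "detour_distance G u v = Max {length p | p. pre_digraph.apath G u p v}"

definition hamiltonian_coloring :: "('a, 'b) pre_digraph \<Rightarrow> ('a \<Rightarrow> nat) \<Rightarrow> bool" where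
  "hamiltonian_coloring G c \<longleftrightarrow>
     (\<forall>u \<in> verts G. \<forall>v \<in> verts G. u \<noteq> v \<longrightarrow>
        int (detour_distance G u v) + \<bar>int (c u) - int (c v)\<bar> \<ge> int (card (verts G)) - 1)"

definition hc_value :: "('a, 'b) pre_digraph \<Rightarrow> ('a \<Rightarrow> nat) \<Rightarrow> nat" where
  "hc_value G c = Max (c ` verts G)"

definition hamiltonian_chromatic_number :: "('a, 'b) pre_digraph \<Rightarrow> nat" where
  "hamiltonian_chromatic_number G =
     (LEAST h. \<exists>c. hamiltonian_coloring G c \<and> hc_value G c = h)"

definition graph_distance :: "('a, 'b) pre_digraph \<Rightarrow> 'a \<Rightarrow> 'a \<Rightarrow> nat" where
  "graph_distance G u v = Min {length p | p. pre_digraph.apath G u p v}"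

definition eccentricity :: "('a, 'b) pre_digraph \<Rightarrow> 'a \<Rightarrow> nat" where
  "eccentricity G u = Max (graph_distance G u ` verts G)"

definition diameter :: "('a, 'b) pre_digraph \<Rightarrow> nat" where
  "diameter G = Max (eccentricity G ` verts G)"

text \<open>
  The library's \<open>forest\<close> and \<open>tree\<close> count a pair of opposite arcs as a cycle, hence reject every
  symmetric digraph with an arc. The cycles of an undirected graph are the directed cycles of
  length at least 3.
\<close>

definition undirected_tree :: "('a, 'b) pre_digraph \<Rightarrow> bool" where
  "undirected_tree G \<longleftrightarrow>
     graph G \<and> Digraph_Component.connected G \<and> \<not> (\<exists>p. pre_digraph.cycle G p \<and> 3 \<le> length p)"

text \<open>In a symmetric digraph without parallel arcs, the out-degree is the degree.\<close>

definition leaf :: "('a, 'b) pre_digraph \<Rightarrow> 'a \<Rightarrow> bool" where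
  "leaf G v \<longleftrightarrow> v \<in> verts G \<and> out_degree G v = 1"

definition symmetric_tree :: "('a, 'b) pre_digraph \<Rightarrow> bool" where
  "symmetric_tree G \<longleftrightarrow> undirected_tree G \<and>
     (\<forall>u \<in> verts G. \<forall>v \<in> verts G. \<not> leaf G u \<longrightarrow> \<not> leaf G v \<longrightarrow> out_degree G u = out_degree G v) \<and>
     (\<forall>u v. leaf G u \<longrightarrow> leaf G v \<longrightarrow> eccentricity G u = eccentricity G v)"

text \<open>
  \<open>is_symmetric_tree r d G\<close>: \<open>G\<close> is (a copy of) the tree \<open>T\<^sub>r(d)\<close>, which is determined only up to
  isomorphism.
\<close>

definition is_symmetric_tree :: "nat \<Rightarrow> nat \<Rightarrow> ('a, 'b) pre_digraph \<Rightarrow> bool" where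
  "is_symmetric_tree r d G \<longleftrightarrow> symmetric_tree G \<and> diameter G = d \<and>
     (\<forall>v \<in> verts G. \<not> leaf G v \<longrightarrow> out_degree G v = r)"

end

theory Submission
  imports Defs
begin

text \<open>
  In a tree the detour distance is the distance. For even \<open>d\<close> the tree has a central vertex, for odd
  \<open>d\<close> a central edge; let \<open>l x\<close> be the distance of \<open>x\<close> to the nearest central vertex and let
  \<open>\<delta>\<close> be 0 or 1 accordingly. Then \<open>D(x, y) \<le> l x + l y + \<delta>\<close>, with equality if the path from \<open>x\<close> to \<open>y\<close>
  runs through the whole centre. Sorting the \<open>n\<close> vertices by colour and adding up the conditions for
  consecutive ones shows that the largest colour is at least
  \<open>(n - 1) (n - 1 - \<delta>) - 2 (\<Sum>x. l x) + 1 - \<delta>\<close>. Equality is attained by visiting the branches at the centre in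
  turn, starting and ending in the centre (for \<open>\<delta> = 0\<close>: ending next to it).
\<close>

section \<open>Colourings from an order of the vertices\<close>

text \<open>The summand 1 - \<delta> comes from the two ends of the order, the only vertices that
  lie in one consecutive pair instead of two: they are distinct, so 1 \<le> D \<le> l + l + \<delta>
  holds for them. An optimal order therefore has to begin and end as centrally as possible. The
  obstacle to attaining the bound is that the colouring condition constrains all pairs, whereas the
  order controls only consecutive ones. It is removed by n \<ge> 2 d, which holds because for k
  \<ge> 2 every level below the root of a branch has at least two vertices. That the branches at the
  centre are equally large makes it possible to visit them in turn without ever staying in the same
  one. The tree structure enters through walks that never turn back at once. Unlike distinctness of
  the vertices this is a local condition, so walks are glued by inspecting the junction only;
  acyclicity makes the two notions agree and walks with given ends unique.\<close>

lemma sum_consecutive: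
  fixes f :: "'a \<Rightarrow> nat"
  assumes "bij_betw u {..<Suc N} V"
  shows "(\<Sum>i<N. f (u i) + f (u (Suc i))) + f (u 0) + f (u N) = 2 * sum f V"
proof -
  have "sum f V = (\<Sum>i<Suc N. f (u i))"
    using sum.reindex_bij_betw[OF assms, of f] by simp
  moreover have "(\<Sum>i<Suc N. f (u i)) = f (u 0) + (\<Sum>i<N. f (u (Suc i)))"
    by (rule sum.lessThan_Suc_shift)
  ultimately show ?thesis by (simp add: sum.distrib)
qed

lemma ex_sorted_enumeration:
  fixes c :: "'a \<Rightarrow> 'b::linorder"
  assumes "finite V"
  obtains u where "bij_betw u {..<card V} V"
    and "\<And>i. Suc i < card V \<Longrightarrow> c (u i) \<le> c (u (Suc i))"
proof -
  obtain xs where xs: "set xs = V" "distinct xs"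
    using finite_distinct_list[OF assms] by blast
  define ys where "ys = sort_key c xs"
  have ys: "set ys = V" "distinct ys" "sorted (map c ys)"
    using xs by (auto simp: ys_def)
  then have len: "length ys = card V" using distinct_card by fastforce
  show thesis
  proof
    show "bij_betw ((!) ys) {..<card V} V"
      using bij_betw_nth[OF ys(2)] ys(1) len by auto
    show "c (ys ! i) \<le> c (ys ! Suc i)" if "Suc i < card V" for i
      using sorted_nth_mono[OF ys(3), of i "Suc i"] that len by simp
  qed
qed

lemma coloring_max_ge:
  fixes c l :: "'a \<Rightarrow> nat" and D :: "'a \<Rightarrow> 'a \<Rightarrow> nat"
  assumes fin: "finite V" and card: "card V \<ge> 2"
    and pos: "\<And>u v. u \<in> V \<Longrightarrow> v \<in> V \<Longrightarrow> u \<noteq> v \<Longrightarrow> D u v \<ge> 1"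
    and le: "\<And>u v. u \<in> V \<Longrightarrow> v \<in> V \<Longrightarrow> u \<noteq> v \<Longrightarrow> D u v \<le> l u + l v + \<delta>"
    and col: "\<And>u v. u \<in> V \<Longrightarrow> v \<in> V \<Longrightarrow> u \<noteq> v \<Longrightarrow>
      int (D u v) + \<bar>int (c u) - int (c v)\<bar> \<ge> int (card V) - 1"
  shows "int (Max (c ` V)) \<ge>
    (int (card V) - 1) * (int (card V) - 1 - int \<delta>) - 2 * int (sum l V) + 1 - int \<delta>"
proof -
  obtain N where N: "card V = Suc N" "N \<ge> 1" using card by (cases "card V") auto
  obtain u where u: "bij_betw u {..<Suc N} V"
    and mono: "\<And>i. Suc i < Suc N \<Longrightarrow> c (u i) \<le> c (u (Suc i))"
    using ex_sorted_enumeration[OF fin, of c] N by metis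
  have mem: "u i \<in> V" if "i \<le> N" for i using u that by (auto simp: bij_betw_def)
  have neq: "u i \<noteq> u j" if "i \<le> N" "j \<le> N" "i \<noteq> j" for i j
    using u that by (auto simp: bij_betw_def inj_on_def)
  have "int (c (u N)) - int (c (u 0)) = (\<Sum>i<N. int (c (u (Suc i))) - int (c (u i)))"
    by (rule sum_lessThan_telescope[symmetric])
  \<comment> \<open>Sortedness removes the absolute value, so each colour difference is at least N -
    D, and D is bounded by l + l + \<delta>.\<close>
  also have "\<dots> \<ge> (\<Sum>i<N. int N - int \<delta> - int (l (u i) + l (u (Suc i))))"
  proof (rule sum_mono)
    fix i assume "i \<in> {..<N}"
    then show "int N - int \<delta> - int (l (u i) + l (u (Suc i))) \<le> int (c (u (Suc i))) - int (c (u i))"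
      using col[OF mem mem neq, of i "Suc i"] le[OF mem mem neq, of i "Suc i"] mono[of i] N by auto
  qed
  also have "(\<Sum>i<N. int N - int \<delta> - int (l (u i) + l (u (Suc i))))
      = int N * (int N - int \<delta>) - int (\<Sum>i<N. l (u i) + l (u (Suc i)))"
    by (simp add: sum_subtractf)
  also have "int (\<Sum>i<N. l (u i) + l (u (Suc i))) = 2 * int (sum l V) - int (l (u 0)) - int (l (u N))"
    using sum_consecutive[OF u, of l] by linarith
  finally have 1: "int (c (u N)) - int (c (u 0)) \<ge>
      int N * (int N - int \<delta>) - 2 * int (sum l V) + int (l (u 0)) + int (l (u N))" by simp
  have 2: "1 \<le> l (u 0) + l (u N) + \<delta>"
    using pos[OF mem mem neq, of 0 N] le[OF mem mem neq, of 0 N] N(2) by force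
  have "c (u N) \<le> Max (c ` V)" using fin mem by auto
  with 1 2 N show ?thesis by auto
qed

text \<open>
  Consecutive vertices in the order \<open>u\<close> are coloured as tightly as possible. For vertices further apart
  the condition is automatic, because two steps already raise the colour by at least
  \<open>2 (card V - 1 - d) \<ge> card V - 2\<close>.
\<close>

lemma ex_coloring_max_eq:
  fixes l :: "'a \<Rightarrow> nat" and D :: "'a \<Rightarrow> 'a \<Rightarrow> nat"
  assumes u: "bij_betw u {..<card V} V" and card: "card V \<ge> 2" and small: "2 * d \<le> card V"
    and sym: "\<And>u v. u \<in> V \<Longrightarrow> v \<in> V \<Longrightarrow> D u v = D v u"
    and pos: "\<And>u v. u \<in> V \<Longrightarrow> v \<in> V \<Longrightarrow> u \<noteq> v \<Longrightarrow> D u v \<ge> 1"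
    and diam: "\<And>u v. u \<in> V \<Longrightarrow> v \<in> V \<Longrightarrow> D u v \<le> d"
    and step: "\<And>i. Suc i < card V \<Longrightarrow> D (u i) (u (Suc i)) = l (u i) + l (u (Suc i)) + \<delta>"
    and ends: "l (u 0) + l (u (card V - 1)) + \<delta> = 1"
  obtains c :: "'a \<Rightarrow> nat" where
    "\<And>u v. u \<in> V \<Longrightarrow> v \<in> V \<Longrightarrow> u \<noteq> v \<Longrightarrow>
      int (D u v) + \<bar>int (c u) - int (c v)\<bar> \<ge> int (card V) - 1"
    and "int (Max (c ` V)) =
      (int (card V) - 1) * (int (card V) - 1 - int \<delta>) - 2 * int (sum l V) + 1 - int \<delta>"
proof -
  obtain N where N: "card V = Suc N" "N \<ge> 1" using card by (cases "card V") auto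
  note u = u[unfolded N]
  have mem: "u i \<in> V" if "i \<le> N" for i using u that by (auto simp: bij_betw_def)
  have neq: "u i \<noteq> u j" if "i \<le> N" "j \<le> N" "i \<noteq> j" for i j
    using u that by (auto simp: bij_betw_def inj_on_def)
  have V: "V = u ` {..N}" using u by (auto simp: bij_betw_def lessThan_Suc_atMost)
  \<comment> \<open>The smallest admissible increase. The subtraction on naturals never truncates,
    since D \<le> d \<le> N by \<open>DN\<close>.\<close>
  define g where "g i = N - D (u i) (u (Suc i))" for i
  define s where "s i = (\<Sum>t<i. g t)" for i
  have DN: "D (u i) (u j) \<le> N" if "i \<le> N" "j \<le> N" for i j
    using diam[OF mem[OF that(1)] mem[OF that(2)]] small N by linarith
  have s_Suc: "s (Suc i) = s i + g i" for i by (simp add: s_def)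
  have s_mono: "s i \<le> s j" if "i \<le> j" for i j
    unfolding s_def using that by (intro sum_mono2) auto
  define c where "c v = s (the_inv_into {..<Suc N} u v)" for v
  have c: "c (u i) = s i" if "i \<le> N" for i
    using the_inv_into_f_f[of u "{..<Suc N}" i] u that by (simp add: c_def bij_betw_def)
  have gap: "D (u i) (u j) + s j \<ge> s i + N" if "i < j" "j \<le> N" for i j
  proof (cases "j = Suc i")
    case True
    then show ?thesis using DN[of i j] that by (simp add: s_Suc g_def)
  next
    case False
    then have ij: "Suc (Suc i) \<le> j" using that by simp
    have "s j \<ge> s i + g i + g (Suc i)" using s_mono[OF ij] by (simp add: s_Suc)
    moreover have "D (u i) (u (Suc i)) \<le> d" "D (u (Suc i)) (u (Suc (Suc i))) \<le> d"
      using ij that by (auto intro!: diam mem)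
    \<comment> \<open>The two increases guarantee only N - 1; the distance itself supplies the
      missing unit.\<close>
    moreover have "D (u i) (u j) \<ge> 1" using that by (intro pos mem neq) auto
    ultimately show ?thesis using small N unfolding g_def by linarith
  qed
  show thesis
  proof
    fix x y assume "x \<in> V" "y \<in> V" "x \<noteq> y"
    then obtain i j where ij: "x = u i" "y = u j" "i \<le> N" "j \<le> N" "i \<noteq> j" unfolding V by auto
    then show "int (D x y) + \<bar>int (c x) - int (c y)\<bar> \<ge> int (card V) - 1"
    proof (cases "i < j")
      case True then show ?thesis using gap[of i j] ij N by (auto simp: c)
    next
      case False then show ?thesis using gap[of j i] ij N sym[OF mem mem, of i j] by (auto simp: c)
    qed
  next
    have "Max (c ` V) = s N"
    proof (rule Max_eqI)
      show "finite (c ` V)" unfolding V by simp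
      show "s N \<in> c ` V" unfolding V using c[of N] by force
      show "y \<le> s N" if "y \<in> c ` V" for y using that s_mono by (auto simp: V c)
    qed
    also have "int (s N) = (\<Sum>i<N. int N - int \<delta> - int (l (u i) + l (u (Suc i))))"
      unfolding s_def of_nat_sum
    proof (rule sum.cong)
      fix i assume "i \<in> {..<N}"
      then show "int (g i) = int N - int \<delta> - int (l (u i) + l (u (Suc i)))"
        using step[of i] DN[of i "Suc i"] N by (simp add: g_def)
    qed simp
    also have "\<dots> = int N * (int N - int \<delta>) - int (\<Sum>i<N. l (u i) + l (u (Suc i)))"
      by (simp add: sum_subtractf)
    also have "int (\<Sum>i<N. l (u i) + l (u (Suc i))) = 2 * int (sum l V) - int (l (u 0)) - int (l (u N))"
      using sum_consecutive[OF u, of l] by linarith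
    also have "int (l (u 0)) + int (l (u N)) + int \<delta> = 1" using ends N by simp
    ultimately show "int (Max (c ` V)) =
      (int (card V) - 1) * (int (card V) - 1 - int \<delta>) - 2 * int (sum l V) + 1 - int \<delta>"
      using N ends by (simp add: algebra_simps)
  qed
qed

text \<open>Any enumeration is corrected by the transposition that swaps its value at
  \<open>i\<close> with \<open>x\<close>.\<close>

lemma ex_bij_betw_fixed:
  assumes "finite B" "card B = m" "i < m" "x \<in> B"
  obtains e where "bij_betw e {..<m} B" "e i = x"
proof -
  obtain g where g: "bij_betw g {..<m} B"
    using ex_bij_betw_nat_finite[OF assms(1)] assms(2) by (auto simp: atLeast0LessThan)
  then have "g i \<in> B" using assms(3) by (auto simp: bij_betw_def)
  then have "bij_betw (Transposition.transpose (g i) x) B B"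
    using assms(4) bij_betw_transpose_iff by fastforce
  then show thesis using that[of "Transposition.transpose (g i) x \<circ> g"] g
    by (auto intro: bij_betw_trans)
qed

text \<open>Dealing in turn: position q receives element number q div r of block q mod r. Equal
  block sizes make this exhaust the union. The prescribed first and last elements serve the
  condition on the ends of an optimal order.\<close>

lemma ex_round_robin:
  fixes B :: "nat \<Rightarrow> 'a set"
  assumes r: "r \<ge> 2" and m: "m \<ge> 1"
    and fin: "\<And>b. b < r \<Longrightarrow> finite (B b)" and card: "\<And>b. b < r \<Longrightarrow> card (B b) = m"
    and disj: "\<And>a b. a < r \<Longrightarrow> b < r \<Longrightarrow> a \<noteq> b \<Longrightarrow> B a \<inter> B b = {}"
    and x: "x \<in> B 0" and y: "y \<in> B (r - 1)"
  obtains u where "bij_betw u {..<r * m} (\<Union>b<r. B b)" "u 0 = x" "u (r * m - 1) = y"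
    and "\<And>q. Suc q < r * m \<Longrightarrow> \<exists>a<r. \<exists>b<r. a \<noteq> b \<and> u q \<in> B a \<and> u (Suc q) \<in> B b"
proof -
  \<comment> \<open>Since r \<ge> 2, the blocks 0 and r - 1 differ, so no block has to satisfy both
    prescriptions; for m = 1 they could clash.\<close>
  have "\<exists>e. bij_betw e {..<m} (B b) \<and> (b = 0 \<longrightarrow> e 0 = x) \<and> (b = r - 1 \<longrightarrow> e (m - 1) = y)"
    if b: "b < r" for b
  proof (cases "b = 0")
    case True
    then show ?thesis
      using ex_bij_betw_fixed[OF fin[OF b] card[OF b], of 0 x] m x r by auto
  next
    case False
    have "B b \<noteq> {}" using card[OF b] m by auto
    then obtain z where "z \<in> B b" "b = r - 1 \<longrightarrow> z = y" using y by auto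
    with False show ?thesis
      using ex_bij_betw_fixed[OF fin[OF b] card[OF b], of "m - 1" z] m by auto
  qed
  then obtain e where e: "\<And>b. b < r \<Longrightarrow> bij_betw (e b) {..<m} (B b)"
    and e0: "e 0 0 = x" and e1: "e (r - 1) (m - 1) = y"
    using r by (metis less_eq_Suc_le diff_less numeral_2_eq_2 Suc_1 less_numeral_extra(1) 
        less_le_trans zero_less_Suc lessI)
  define u where "u q = e (q mod r) (q div r)" for q
  have r0: "r > 0" using r by simp
  have div: "q div r < m" if "q < r * m" for q
    using that r0 by (simp add: less_mult_imp_div_less mult.commute)
  have u_in: "u q \<in> B (q mod r)" if "q < r * m" for q
    using e[of "q mod r"] div[OF that] r0 by (auto simp: u_def bij_betw_def)
  show thesis
  proof
    have "inj_on u {..<r * m}"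
    proof (rule inj_onI)
      fix p q assume pq: "p \<in> {..<r * m}" "q \<in> {..<r * m}" "u p = u q"
      then have m_eq: "p mod r = q mod r"
        using disj[of "p mod r" "q mod r"] u_in[of p] u_in[of q] r0 by fastforce
      moreover have "p div r = q div r"
        using pq m_eq e[of "q mod r"] div r0 by (auto simp: u_def bij_betw_def inj_on_def)
      ultimately show "p = q" by (metis div_mult_mod_eq)
    qed
    moreover have "u ` {..<r * m} = (\<Union>b<r. B b)"
    proof
      show "u ` {..<r * m} \<subseteq> (\<Union>b<r. B b)" using u_in r0 by fastforce
      show "(\<Union>b<r. B b) \<subseteq> u ` {..<r * m}"
      proof
        fix z assume "z \<in> (\<Union>b<r. B b)"
        then obtain b where b: "b < r" "z \<in> B b" by auto
        then obtain j where j: "j < m" "z = e b j" using e[OF b(1)] by (auto simp: bij_betw_def)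
        have "r * j + b < r * Suc j" using b by simp
        also have "\<dots> \<le> r * m" using j by (intro mult_le_mono2) simp
        finally have "r * j + b < r * m" .
        moreover have "u (r * j + b) = z" using b j by (simp add: u_def)
        ultimately show "z \<in> u ` {..<r * m}" by force
      qed
    qed
    ultimately show "bij_betw u {..<r * m} (\<Union>b<r. B b)" by (simp add: bij_betw_def)
    show "u 0 = x" using e0 by (simp add: u_def)
    \<comment> \<open>Rewriting the last position as r' + r * m' shows its residue r - 1 and its
      quotient m - 1.\<close>
    define m' r' where "m' = m - 1" and "r' = r - 1"
    then have mr: "m = Suc m'" "r = Suc r'" using r m by auto
    then have "r * m - 1 = r' + r * m'" by simp
    moreover have "r' < r" using mr by simp
    then have "(r' + r * m') mod r = r'" "(r' + r * m') div r = m'" by simp_all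
    ultimately show "u (r * m - 1) = y" using e1 by (simp add: u_def m'_def r'_def)
    show "\<exists>a<r. \<exists>b<r. a \<noteq> b \<and> u q \<in> B a \<and> u (Suc q) \<in> B b" if "Suc q < r * m" for q
    proof -
      have "q mod r \<noteq> Suc q mod r" using r by (simp add: mod_Suc)
      moreover have "u q \<in> B (q mod r)" "u (Suc q) \<in> B (Suc q mod r)"
        using u_in that by auto
      ultimately show ?thesis using r0 by (meson mod_less_divisor)
    qed
  qed
qed

section \<open>Non-backtracking walks and branches in trees\<close>

text \<open>A local substitute for paths: only neighbours at distance two in the list must differ.
  The empty list is excluded so that every walk has a first and a last vertex.\<close>

fun nb_walk :: "('a \<Rightarrow> 'a \<Rightarrow> bool) \<Rightarrow> 'a list \<Rightarrow> bool" where
  "nb_walk E [] \<longleftrightarrow> False"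
| "nb_walk E [x] \<longleftrightarrow> True"
| "nb_walk E [x, y] \<longleftrightarrow> E x y"
| "nb_walk E (x # y # z # zs) \<longleftrightarrow> E x y \<and> x \<noteq> z \<and> nb_walk E (y # z # zs)"

lemma nb_walk_successively: "nb_walk E xs \<Longrightarrow> successively E xs"
  by (induction E xs rule: nb_walk.induct) auto

text \<open>Each condition concerns at most three consecutive vertices, and these lie in one of the
  two pieces once the pieces share two vertices.\<close>

lemma nb_walk_append_overlap:
  "nb_walk E (xs @ x # y # ys) \<longleftrightarrow> nb_walk E (xs @ [x, y]) \<and> nb_walk E (x # y # ys)"
proof (induction xs)
  case Nil
  then show ?case by (cases ys) auto
next
  case (Cons a xs)
  show ?case
  proof (cases xs)
    case Nil
    then show ?thesis by (cases ys) auto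
  next
    case (Cons b xs')
    then show ?thesis using Cons.IH by (cases xs') auto
  qed
qed

lemma nb_walk_edge: "nb_walk E (x # y # ys) \<Longrightarrow> E x y"
  by (cases ys) auto

lemma nb_walk_appendD1: "nb_walk E (xs @ ys) \<Longrightarrow> xs \<noteq> [] \<Longrightarrow> nb_walk E xs"
proof (induction E xs rule: nb_walk.induct)
  case (3 E x y)
  then show ?case by (cases ys) auto
qed auto

lemma nb_walk_ConsD: "nb_walk E (x # xs) \<Longrightarrow> xs \<noteq> [] \<Longrightarrow> nb_walk E xs"
  by (cases "(E, x # xs)" rule: nb_walk.cases) auto

lemma nb_walk_appendD2: "nb_walk E (xs @ ys) \<Longrightarrow> ys \<noteq> [] \<Longrightarrow> nb_walk E ys"
  by (induction xs) (auto dest: nb_walk_ConsD)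

lemma nb_walk_rev: "nb_walk E xs \<Longrightarrow> (\<And>u v. E u v \<Longrightarrow> E v u) \<Longrightarrow> nb_walk E (rev xs)"
proof (induction E xs rule: nb_walk.induct)
  case (4 E x y z zs)
  then have "nb_walk E (rev zs @ [z, y])" "nb_walk E [z, y, x]"
    using nb_walk_edge[of E y z zs] by auto
  then show ?case using nb_walk_append_overlap[of E "rev zs" z y "[x]"] by simp
qed auto

text \<open>In \<open>acyclic\<close> a cycle is listed without repeating its first vertex; the
  bound 3 prevents an edge traversed back and forth from counting as a cycle.\<close>

locale vertex_tree =
  fixes V :: "'a set" and E :: "'a \<Rightarrow> 'a \<Rightarrow> bool"
  assumes finite_V: "finite V"
    and E_in_V: "E u v \<Longrightarrow> u \<in> V"
    and E_sym: "E u v \<Longrightarrow> E v u"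
    and E_irrefl: "\<not> E u u"
    and connected: "u \<in> V \<Longrightarrow> v \<in> V \<Longrightarrow> E\<^sup>*\<^sup>* u v"
    and acyclic: "distinct xs \<Longrightarrow> 3 \<le> length xs \<Longrightarrow> successively E xs \<Longrightarrow> \<not> E (last xs) (hd xs)"
begin

abbreviation "nb \<equiv> nb_walk E"

definition nbrs :: "'a \<Rightarrow> 'a set" where "nbrs v = {u. E v u}"

lemma nbrs_subset: "nbrs v \<subseteq> V"
  using E_in_V E_sym by (auto simp: nbrs_def)

lemma finite_nbrs: "finite (nbrs v)"
  using nbrs_subset finite_V by (rule finite_subset)

lemma E_in_V2: "E u v \<Longrightarrow> v \<in> V"
  using E_in_V E_sym by blast

lemma nb_rev: "nb xs \<Longrightarrow> nb (rev xs)"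
  using nb_walk_rev E_sym by metis

text \<open>The only new triple at the junction is x, v, y.\<close>

lemma nb_join:
  assumes "nb (xs @ [x, v])" "nb (v # y # ys)" "x \<noteq> y"
  shows "nb (xs @ x # v # y # ys)"
  using assms nb_walk_append_overlap[of E xs x v "y # ys"] nb_walk_append_overlap[of E "[]" x v "y # ys"]
    nb_walk_appendD2[of E xs "[x, v]"]
  by simp

text \<open>
  In a shortest counterexample only the two ends coincide, so it is a loop, a backtrack or a cycle.
\<close>

lemma nb_distinct: "nb xs \<Longrightarrow> distinct xs"
proof (induction "length xs" arbitrary: xs rule: less_induct)
  case less
  show ?case
  proof (rule ccontr)
    assume nd: "\<not> distinct xs"
    then obtain a ys where xs: "xs = a # ys" by (cases xs) auto
    with nd have "ys \<noteq> []" by auto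
    then obtain bs z where ys: "ys = bs @ [z]" by (meson rev_exhaust)
    have "distinct ys"
      using less(1)[of ys] nb_walk_ConsD[of E a ys] less(2) xs \<open>ys \<noteq> []\<close> by simp
    then have "distinct (bs @ [z])" unfolding ys .
    moreover have nb': "nb (a # bs)" "distinct (a # bs)"
      using less(1)[of "a # bs"] less(2) nb_walk_appendD1[of E "a # bs" "[z]"] xs ys by auto
    ultimately have az: "a = z" using nd xs ys by auto
    have suc: "successively E (a # bs @ [a])"
      using nb_walk_successively[OF less(2)] xs ys az by simp
    then have last: "E (last (a # bs)) (hd (a # bs))"
      using successively_append_iff[of E "a # bs" "[a]"] by auto
    consider "bs = []" | y where "bs = [y]" | "length bs \<ge> 2"
      by (cases bs; cases "tl bs") (auto simp: Suc_le_eq)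
    then show False
    proof cases
      case 1 then show False using last E_irrefl by auto
    next
      case 2 then show False using less(2) xs ys az by auto
    next
      case 3 then show False
        using acyclic[OF nb'(2)] nb_walk_successively[OF nb'(1)] last by auto
    qed
  qed
qed

lemma distinct_nb: "distinct xs \<Longrightarrow> xs \<noteq> [] \<Longrightarrow> successively E xs \<Longrightarrow> nb xs"
  by (induction E xs rule: nb_walk.induct) auto

text \<open>
  Where two such walks with the same ends diverge, reversing one and following the other does not
  backtrack, and yet this walk is closed.
\<close>

lemma nb_unique: "nb xs \<Longrightarrow> nb ys \<Longrightarrow> hd xs = hd ys \<Longrightarrow> last xs = last ys \<Longrightarrow> xs = ys"
proof (induction xs arbitrary: ys)
  case (Cons v xs)
  then obtain ys' where ys: "ys = v # ys'" by (cases ys) auto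
  note dist = nb_distinct[OF Cons.prems(1)] nb_distinct[OF Cons.prems(2)]
  show ?case
  proof (cases "xs = [] \<or> ys' = []")
    case True
    then show ?thesis using Cons.prems dist ys by (auto split: if_splits)
  next
    case False
    then obtain a as b bs where ab: "xs = a # as" "ys' = b # bs" by (auto simp: neq_Nil_conv)
    show ?thesis
    proof (cases "a = b")
      case True
      then show ?thesis
        using Cons.IH[of ys'] Cons.prems ab ys nb_walk_ConsD by fastforce
    next
      case False
      have "nb (rev as @ [a, v])" using nb_rev[OF Cons.prems(1)] ab by simp
      then have "nb (rev as @ a # v # b # bs)"
        using nb_join Cons.prems(2) False ab ys by auto
      then have "distinct (rev as @ a # v # b # bs)" by (rule nb_distinct)
      moreover have "last (a # as) = last (b # bs)" using Cons.prems ab ys by simp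
      moreover have "last (a # as) \<in> set (a # as)" "last (b # bs) \<in> set (b # bs)"
        using last_in_set by blast+
      ultimately show ?thesis by fastforce
    qed
  qed
qed simp

text \<open>If the step from \<open>x\<close> would be undone at once, cancelling the first vertex
  of \<open>ys\<close> leaves a walk that already starts in \<open>x\<close>; otherwise
  \<open>x\<close> is simply put in front.\<close>

lemma nb_prepend:
  assumes "E x (hd ys)" "nb ys"
  obtains zs where "nb zs" "hd zs = x" "last zs = last ys" "length zs \<le> Suc (length ys)"
proof -
  obtain y ys' where ys: "ys = y # ys'" using assms(2) by (cases ys) auto
  show thesis
  proof (cases "ys' \<noteq> [] \<and> hd ys' = x")
    case True
    then show thesis using that[of ys'] assms nb_walk_ConsD[of E y ys'] ys by auto
  next
    case False
    then have "nb (x # ys)" using assms ys by (cases ys') auto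
    then show thesis using that[of "x # ys"] ys by auto
  qed
qed

section \<open>Distances along the unique walk\<close>

lemma ex_nb:
  assumes "u \<in> V" "v \<in> V"
  shows "\<exists>xs. nb xs \<and> hd xs = u \<and> last xs = v"
  using connected[OF assms]
proof (induction rule: converse_rtranclp_induct)
  case base
  then show ?case by (intro exI[of _ "[v]"]) simp
next
  case (step x y)
  then show ?case by (metis nb_prepend)
qed

text \<open>The description is proper on vertices of the tree by \<open>ex_nb\<close> and
  \<open>nb_unique\<close>. The list counts vertices, hence the subtraction of 1.\<close>

definition tdist :: "'a \<Rightarrow> 'a \<Rightarrow> nat" where
  "tdist u v = length (THE xs. nb xs \<and> hd xs = u \<and> last xs = v) - 1"

lemma tdist_eq:
  assumes "nb xs" "hd xs = u" "last xs = v"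
  shows "tdist u v = length xs - 1"
proof -
  have "(THE xs. nb xs \<and> hd xs = u \<and> last xs = v) = xs"
    using assms nb_unique by (intro the_equality) auto
  then show ?thesis by (simp add: tdist_def)
qed

lemma tdist_walk: "nb (u # xs) \<Longrightarrow> tdist u (last (u # xs)) = length xs"
  using tdist_eq[of "u # xs"] by simp

lemma tdist_self: "tdist u u = 0"
  using tdist_eq[of "[u]"] by simp

lemma ex_nb_Cons:
  assumes "u \<in> V" "v \<in> V"
  obtains xs where "nb (u # xs)" "last (u # xs) = v" "tdist u v = length xs"
proof -
  obtain ys where "nb ys" "hd ys = u" "last ys = v" using ex_nb[OF assms] by auto
  then show thesis using that[of "tl ys"] tdist_eq[of ys] by (cases ys) auto
qed

lemma tdist_commute:
  assumes "u \<in> V" "v \<in> V"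
  shows "tdist u v = tdist v u"
proof -
  obtain xs where xs: "nb xs" "hd xs = u" "last xs = v" using ex_nb[OF assms] by auto
  moreover have "hd (rev xs) = v" "last (rev xs) = u"
    using xs by (auto simp: hd_rev last_rev)
  ultimately show ?thesis using tdist_eq[of xs] tdist_eq[of "rev xs"] nb_rev by auto
qed

lemma tdist_pos:
  assumes "u \<in> V" "v \<in> V" "u \<noteq> v"
  shows "tdist u v \<ge> 1"
proof -
  obtain xs where "nb (u # xs)" "last (u # xs) = v" "tdist u v = length xs"
    using ex_nb_Cons[OF assms(1,2)] by blast
  then show ?thesis using assms by (cases xs) auto
qed

text \<open>The vertices of the walk from \<open>u\<close> to \<open>v\<close> are put one by one in
  front of the walk from \<open>v\<close> to \<open>w\<close>, with cancellation; each adds at most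
  one to the length.\<close>

lemma tdist_triangle:
  assumes "u \<in> V" "v \<in> V" "w \<in> V"
  shows "tdist u w \<le> tdist u v + tdist v w"
proof -
  obtain ys where ys: "nb (v # ys)" "last (v # ys) = w" "tdist v w = length ys"
    using ex_nb_Cons[OF assms(2,3)] by blast
  have *: "\<exists>zs. nb zs \<and> hd zs = hd xs \<and> last zs = w \<and> length zs \<le> length xs + length ys"
    if "nb xs" "last xs = v" for xs
    using that
  proof (induction xs)
    case (Cons x xs)
    show ?case
    proof (cases "xs = []")
      case True
      then show ?thesis using Cons.prems ys by (intro exI[of _ "v # ys"]) auto
    next
      case False
      then obtain zs where zs: "nb zs" "hd zs = hd xs" "last zs = w"
        "length zs \<le> length xs + length ys"
        using Cons nb_walk_ConsD[OF Cons.prems(1)] by auto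
      have "E x (hd xs)" using nb_walk_successively[OF Cons.prems(1)] False
        by (auto simp: successively_Cons)
      then have "E x (hd zs)" using zs(2) by simp
      then obtain ws where "nb ws" "hd ws = x" "last ws = last zs" "length ws \<le> Suc (length zs)"
        using zs(1) by (rule nb_prepend)
      then show ?thesis using zs(3,4) by (intro exI[of _ ws]) simp
    qed
  qed simp
  obtain xs where xs: "nb (u # xs)" "last (u # xs) = v" "tdist u v = length xs"
    using ex_nb_Cons[OF assms(1,2)] by blast
  obtain zs where "nb zs" "hd zs = u" "last zs = w" "length zs \<le> Suc (length xs) + length ys"
    using *[OF xs(1,2)] by auto
  then show ?thesis using tdist_eq[of zs] xs ys by auto
qed

section \<open>Branches and distances between them\<close>

text \<open>For an edge, this is the component of \<open>b\<close> after the edge is deleted.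
  Indexing by directed edges covers the subtrees at a central vertex, the two halves at a central
  edge, and the subtrees met in the recursion.\<close>

definition branch :: "'a \<Rightarrow> 'a \<Rightarrow> 'a set" where
  "branch a b = {last (b # q) | q. nb (a # b # q)}"

lemma branchI: "nb (a # b # q) \<Longrightarrow> last (b # q) = x \<Longrightarrow> x \<in> branch a b"
  unfolding branch_def by blast

lemma branchE:
  assumes "x \<in> branch a b"
  obtains q where "nb (a # b # q)" "last (b # q) = x" "tdist a x = Suc (length q)" "tdist b x = length q"
proof -
  obtain q where q: "nb (a # b # q)" "last (b # q) = x" using assms by (auto simp: branch_def)
  then show thesis using that tdist_walk[of a "b # q"] tdist_walk[of b q] nb_walk_ConsD[OF q(1)] by auto
qed

lemma nb_set: "nb xs \<Longrightarrow> hd xs \<in> V \<Longrightarrow> set xs \<subseteq> V"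
proof (induction xs)
  case (Cons x xs)
  show ?case
  proof (cases xs)
    case Nil
    then show ?thesis using Cons.prems by simp
  next
    case ys: (Cons y ys)
    then show ?thesis
      using Cons.IH Cons.prems nb_walk_ConsD[of E x xs] nb_walk_edge[of E x y ys] E_in_V2 by simp
  qed
qed simp

lemma branch_subset: "branch a b \<subseteq> V"
proof
  fix x assume "x \<in> branch a b"
  then obtain q where q: "nb (a # b # q)" "last (b # q) = x" by (auto simp: branch_def)
  then have "E a b" by (cases q) auto
  then have "set (a # b # q) \<subseteq> V" using nb_set[OF q(1)] E_in_V by simp
  moreover have "x \<in> set (a # b # q)" using q(2) last_in_set[of "b # q"] by auto
  ultimately show "x \<in> V" by blast
qed

lemma finite_branch: "finite (branch a b)"
  using branch_subset finite_V by (rule finite_subset)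

lemma root_in_branch: "E a b \<Longrightarrow> b \<in> branch a b"
  unfolding branch_def by (rule CollectI, rule exI[of _ "[]"]) simp

lemma start_notin_branch: "a \<notin> branch a b"
  using tdist_self by (auto elim!: branchE)

lemma branch_disjoint:
  assumes "b \<noteq> c"
  shows "branch a b \<inter> branch a c = {}"
proof (rule ccontr)
  assume "branch a b \<inter> branch a c \<noteq> {}"
  then obtain x where "x \<in> branch a b" "x \<in> branch a c" by auto
  then obtain q r where "nb (a # b # q)" "last (b # q) = x" "nb (a # c # r)" "last (c # r) = x"
    by (auto simp: branch_def)
  then show False using nb_unique[of "a # b # q" "a # c # r"] assms by auto
qed

text \<open>A common vertex would be reached from \<open>b\<close> both inside the branch and
  through \<open>a\<close>; by uniqueness the walk a, b, ... would return to
  \<open>a\<close>.\<close>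

lemma opposite_branch_disjoint: "branch a b \<inter> branch b a = {}"
proof (rule ccontr)
  assume "branch a b \<inter> branch b a \<noteq> {}"
  then obtain x where "x \<in> branch a b" "x \<in> branch b a" by auto
  then obtain q r where qr: "nb (a # b # q)" "last (b # q) = x" "nb (b # a # r)" "last (a # r) = x"
    by (auto simp: branch_def)
  then have "b # q = b # a # r" using nb_unique[of "b # q" "b # a # r"] nb_walk_ConsD[of E a "b # q"] by auto
  then show False using nb_distinct[OF qr(1)] by auto
qed

text \<open>The walks a, b, ... are sorted by their third vertex, which is not \<open>a\<close>
  because they do not turn back. This drives the recursive counting.\<close>

lemma branch_decomp:
  assumes "E a b"
  shows "branch a b = insert b (\<Union>c\<in>nbrs b - {a}. branch b c)"
proof (intro equalityI subsetI)
  fix x assume "x \<in> branch a b"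
  then obtain q where q: "nb (a # b # q)" "last (b # q) = x" by (auto simp: branch_def)
  show "x \<in> insert b (\<Union>c\<in>nbrs b - {a}. branch b c)"
  proof (cases q)
    case (Cons c q')
    then have "c \<noteq> a" and nb: "nb (b # c # q')" using q by auto
    have "x \<in> branch b c" by (rule branchI[OF nb]) (use q Cons in simp)
    moreover have "E b c" using nb by (rule nb_walk_edge)
    ultimately show ?thesis using \<open>c \<noteq> a\<close> by (auto simp: nbrs_def)
  qed (use q in auto)
next
  fix x assume "x \<in> insert b (\<Union>c\<in>nbrs b - {a}. branch b c)"
  then consider "x = b" | c where "E b c" "c \<noteq> a" "x \<in> branch b c" by (auto simp: nbrs_def)
  then show "x \<in> branch a b"
  proof cases
    case 2
    then obtain q where "nb (b # c # q)" "last (c # q) = x" by (auto simp: branch_def)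
    then have "nb (a # b # c # q)" "last (b # c # q) = x" using assms 2 by auto
    then show ?thesis by (rule branchI)
  qed (use assms root_in_branch in auto)
qed

lemma V_vertex_decomp:
  assumes "w \<in> V"
  shows "V = insert w (\<Union>b\<in>nbrs w. branch w b)"
proof (intro equalityI subsetI)
  fix x assume "x \<in> V"
  then obtain xs where xs: "nb (w # xs)" "last (w # xs) = x" using ex_nb_Cons[OF assms] by blast
  show "x \<in> insert w (\<Union>b\<in>nbrs w. branch w b)"
  proof (cases xs)
    case (Cons b q)
    then have nb: "nb (w # b # q)" using xs by auto
    have "x \<in> branch w b" by (rule branchI[OF nb]) (use xs Cons in simp)
    moreover have "E w b" using nb by (rule nb_walk_edge)
    ultimately show ?thesis by (auto simp: nbrs_def)
  qed (use xs in auto)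
qed (use assms branch_subset in auto)

lemma V_edge_decomp:
  assumes "E a b"
  shows "V = branch a b \<union> branch b a"
proof (intro equalityI subsetI)
  fix x assume "x \<in> V"
  moreover have "a \<in> V" using assms E_in_V by simp
  ultimately obtain xs where xs: "nb (a # xs)" "last (a # xs) = x" using ex_nb_Cons by blast
  show "x \<in> branch a b \<union> branch b a"
  proof (cases "xs \<noteq> [] \<and> hd xs = b")
    case True
    then have "xs = b # tl xs" by (cases xs) auto
    then have "x \<in> branch a b" using xs branchI[of a b "tl xs" x] by (metis last_ConsR list.distinct(1))
    then show ?thesis ..
  next
    case False
    \<comment> \<open>A walk from \<open>a\<close> that does not begin with the step to
      \<open>b\<close> may be entered from \<open>b\<close>; this includes the trivial walk at
      \<open>a\<close>.\<close>
    then have "nb (b # a # xs)" using xs E_sym[OF assms] by (cases xs) auto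
    then have "x \<in> branch b a" using xs(2) by (rule branchI)
    then show ?thesis ..
  qed
qed (use branch_subset in auto)

text \<open>The reversed walk from \<open>x\<close> to \<open>w\<close> and the walk from
  \<open>w\<close> to \<open>y\<close> are glued at \<open>w\<close>, where b \<noteq> c excludes
  turning back.\<close>

lemma tdist_between_branches:
  assumes "x \<in> branch w b" "y \<in> branch w c" "b \<noteq> c"
  shows "tdist x y = tdist w x + tdist w y"
proof -
  obtain q where q: "nb (w # b # q)" "last (b # q) = x" "tdist w x = Suc (length q)"
    using branchE[OF assms(1)] by metis
  obtain r where r: "nb (w # c # r)" "last (c # r) = y" "tdist w y = Suc (length r)"
    using branchE[OF assms(2)] by metis
  have "nb (rev q @ [b, w])" using nb_rev[OF q(1)] by simp
  then have "nb (rev q @ b # w # c # r)" using r(1) assms(3) by (rule nb_join)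
  moreover have "hd (rev q @ b # w # c # r) = x" using q(2) by (cases q rule: rev_cases) auto
  moreover have "last (rev q @ b # w # c # r) = y" using r(2) by simp
  ultimately show ?thesis using tdist_eq[of "rev q @ b # w # c # r" x y] q r by simp
qed

text \<open>Both walks contain the central edge, so they overlap in two vertices and glue along it;
  the edge contributes the 1.\<close>

lemma tdist_across_edge:
  assumes "x \<in> branch b a" "y \<in> branch a b"
  shows "tdist x y = tdist a x + tdist b y + 1"
proof -
  obtain q where q: "nb (b # a # q)" "last (a # q) = x" "tdist a x = length q"
    using branchE[OF assms(1)] by metis
  obtain r where r: "nb (a # b # r)" "last (b # r) = y" "tdist b y = length r"
    using branchE[OF assms(2)] by metis
  have "nb (rev q @ [a, b])" using nb_rev[OF q(1)] by simp
  then have "nb (rev q @ a # b # r)"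
    using r(1) nb_walk_append_overlap[of E "rev q" a b r] by simp
  moreover have "hd (rev q @ a # b # r) = x" using q(2) by (cases q rule: rev_cases) auto
  moreover have "last (rev q @ a # b # r) = y" using r(2) by simp
  ultimately show ?thesis using tdist_eq[of "rev q @ a # b # r" x y] q r by simp
qed

text \<open>
  The vertices at depth less than \<open>h\<close> have \<open>k\<close> children: their degree \<open>k + 1\<close> also counts the parent.
\<close>

definition regular_branch :: "nat \<Rightarrow> nat \<Rightarrow> 'a \<Rightarrow> 'a \<Rightarrow> bool" where
  "regular_branch k h a b \<longleftrightarrow> E a b \<and>
     (\<forall>x\<in>branch a b. tdist b x \<le> h \<and> (tdist b x < h \<longrightarrow> card (nbrs x) = k + 1))"

text \<open>Level i below \<open>b\<close> has k^i vertices, all at distance i + 1 from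
  \<open>a\<close>. Measuring from \<open>a\<close> instead of \<open>b\<close> suits the induction:
  in the branch from \<open>b\<close> to a child the hypothesis is about distances from
  \<open>b\<close>.\<close>

lemma regular_branch_card_sum:
  assumes "regular_branch k h a b"
  shows "card (branch a b) = (\<Sum>i\<le>h. k ^ i) \<and> (\<Sum>x\<in>branch a b. tdist a x) = (\<Sum>i\<le>h. (i + 1) * k ^ i)"
  using assms
proof (induction h arbitrary: a b)
  case 0
  then have E: "E a b" and *: "\<And>x. x \<in> branch a b \<Longrightarrow> tdist b x = 0"
    by (auto simp: regular_branch_def)
  have "branch a b = {b}"
  proof -
    have "x = b" if "x \<in> branch a b" for x
      using *[OF that] tdist_pos[of b x] that root_in_branch[OF E] branch_subset[of a b] by fastforce
    then show ?thesis using root_in_branch[OF E] by blast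
  qed
  moreover have "tdist a b = 1" using tdist_walk[of a "[b]"] E by simp
  ultimately show ?case by simp
next
  case (Suc h)
  then have E: "E a b" and *: "\<And>x. x \<in> branch a b \<Longrightarrow> tdist b x \<le> Suc h \<and> (tdist b x < Suc h \<longrightarrow> card (nbrs x) = k + 1)"
    by (auto simp: regular_branch_def)
  let ?C = "nbrs b - {a}"
  have sub: "branch b c \<subseteq> branch a b" if "c \<in> ?C" for c
    using branch_decomp[OF E] that by auto
  have shift: "tdist b x = Suc (tdist c x)" if "x \<in> branch b c" for c x
    using branchE[OF that] by metis
  have "regular_branch k h b c" if "c \<in> ?C" for c
    unfolding regular_branch_def
    using that * sub[OF that] shift by (fastforce simp: nbrs_def)
  note IH = Suc.IH[OF this]
  \<comment> \<open>The root has depth 0 < \<open>Suc h\<close>, hence degree k + 1, and the parent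
    \<open>a\<close> is removed.\<close>
  have cardC: "card ?C = k"
    using *[OF root_in_branch[OF E]] tdist_self E_sym[OF E] finite_nbrs by (simp add: nbrs_def)
  have fin: "finite ?C" using finite_nbrs by simp
  have disj: "\<And>c d. c \<in> ?C \<Longrightarrow> d \<in> ?C \<Longrightarrow> c \<noteq> d \<Longrightarrow> branch b c \<inter> branch b d = {}"
    using branch_disjoint by blast
  have notin: "b \<notin> (\<Union>c\<in>?C. branch b c)" using start_notin_branch by auto
  have finU: "finite (\<Union>c\<in>?C. branch b c)" using fin finite_branch by auto
  have geom: "(\<Sum>i\<le>Suc h. k ^ i) = 1 + k * (\<Sum>i\<le>h. k ^ i)"
    by (subst sum.atMost_Suc_shift) (simp add: sum_distrib_left)
  have c: "card (branch a b) = (\<Sum>i\<le>Suc h. k ^ i)"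
  proof -
    have "card (\<Union>c\<in>?C. branch b c) = (\<Sum>c\<in>?C. card (branch b c))"
      using fin finite_branch disj by (intro card_UN_disjoint) auto
    also have "\<dots> = k * (\<Sum>i\<le>h. k ^ i)" using IH cardC by simp
    finally show ?thesis using branch_decomp[OF E] notin finU geom by simp
  qed
  have up: "tdist a x = Suc (tdist b x)" if "x \<in> branch a b" for x using branchE[OF that] by metis
  \<comment> \<open>One step from \<open>a\<close> to \<open>b\<close> is split off for every
    vertex; the rest is measured from \<open>b\<close>, where \<open>b\<close> itself contributes
    0.\<close>
  have "(\<Sum>x\<in>branch a b. tdist a x) = card (branch a b) + (\<Sum>x\<in>branch a b. tdist b x)"
    using up by (simp add: sum_Suc)
  also have "(\<Sum>x\<in>branch a b. tdist b x) = (\<Sum>x\<in>(\<Union>c\<in>?C. branch b c). tdist b x)"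
    using branch_decomp[OF E] notin finU tdist_self by simp
  also have "\<dots> = (\<Sum>c\<in>?C. \<Sum>x\<in>branch b c. tdist b x)"
    using fin finite_branch disj by (intro sum.UNION_disjoint) auto
  also have "\<dots> = k * (\<Sum>i\<le>h. (i + 1) * k ^ i)" using IH cardC by simp
  also have "card (branch a b) + \<dots> = (\<Sum>i\<le>Suc h. (i + 1) * k ^ i)"
  proof -
    have "(\<Sum>i\<le>Suc h. (i + 1) * k ^ i) = (\<Sum>i\<le>Suc h. k ^ i) + (\<Sum>i\<le>Suc h. i * k ^ i)"
      by (simp add: sum.distrib algebra_simps)
    also have "(\<Sum>i\<le>Suc h. i * k ^ i) = k * (\<Sum>i\<le>h. (i + 1) * k ^ i)"
      by (subst sum.atMost_Suc_shift) (simp add: sum_distrib_left algebra_simps)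
    finally show ?thesis using c by simp
  qed
  finally show ?case using c by simp
qed

end

section \<open>The centre of the tree\<close>

lemma bij_betw_case_nat:
  assumes "bij_betw u {..<n} W" "w \<notin> W"
  shows "bij_betw (case_nat w u) {..<Suc n} (insert w W)"
proof -
  have img: "case_nat w u ` {..<Suc n} = insert w W"
    using assms by (auto simp: lessThan_Suc_eq_insert_0 bij_betw_def image_image)
  have "inj_on (case_nat w u) {..<Suc n}"
  proof (rule inj_onI)
    fix i j assume "i \<in> {..<Suc n}" "j \<in> {..<Suc n}" "case_nat w u i = case_nat w u j"
    then show "i = j" using assms by (cases i; cases j) (auto simp: bij_betw_def inj_on_def)
  qed
  with img show ?thesis by (simp add: bij_betw_def)
qed

text \<open>The source of the condition that twice the diameter is at most the number of vertices:
  each further level contributes at least 2.\<close>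

lemma geometric_ge:
  fixes k :: nat
  assumes "k \<ge> 2"
  shows "(\<Sum>i\<le>h. k ^ i) \<ge> 2 * h + 1"
proof (induction h)
  case (Suc h)
  have "2 \<le> (2::nat) ^ Suc h" by simp
  also have "\<dots> \<le> k ^ Suc h" using assms by (rule power_mono) simp
  finally show ?case using Suc by simp
qed simp

lemma length_split:
  assumes "length p = m + n"
  obtains xs ys where "p = xs @ ys" "length xs = m" "length ys = n"
  using that[of "take m p" "drop m p"] assms by simp

context vertex_tree
begin

text \<open>A second neighbour of \<open>u\<close> would extend the walk to length d + 1. This
  provides a leaf of eccentricity d, to which all other leaves are then compared.\<close>

lemma end_of_longest_path_card_nbrs:
  assumes uv: "u \<in> V" "v \<in> V" "tdist u v = d" "d \<ge> 1"
    and le: "\<And>x y. x \<in> V \<Longrightarrow> y \<in> V \<Longrightarrow> tdist x y \<le> d"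
  shows "card (nbrs u) = 1"
proof -
  obtain xs where xs: "nb (u # xs)" "last (u # xs) = v" "tdist u v = length xs"
    using ex_nb_Cons[OF uv(1,2)] by blast
  then obtain b q where q: "xs = b # q" using uv by (cases xs) auto
  have "z = b" if z: "E u z" for z
  proof (rule ccontr)
    assume "z \<noteq> b"
    then have "nb (z # u # b # q)" using xs q E_sym[OF z] by simp
    then have "tdist z v = Suc d" using tdist_walk[of z "u # xs"] xs uv q by simp
    then show False using le[of z v] E_in_V2[OF z] uv by simp
  qed
  moreover have "E u b" using xs(1) unfolding q by (rule nb_walk_edge)
  ultimately have "nbrs u = {b}" unfolding nbrs_def by blast
  then show ?thesis by simp
qed

end

text \<open>Equal eccentricity of the leaves is expressed as eccentricity \<open>d\<close>, the
  value at the ends of a longest path.\<close>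

locale leaf_regular_tree = vertex_tree +
  fixes k d :: nat
  assumes k: "k \<ge> 2" and d: "d \<ge> 2"
    and tdist_le: "u \<in> V \<Longrightarrow> v \<in> V \<Longrightarrow> tdist u v \<le> d"
    and diameter_attained: "\<exists>u\<in>V. \<exists>v\<in>V. tdist u v = d"
    and inner_degree: "v \<in> V \<Longrightarrow> card (nbrs v) \<noteq> 1 \<Longrightarrow> card (nbrs v) = k + 1"
    and leaf_eccentricity: "v \<in> V \<Longrightarrow> card (nbrs v) = 1 \<Longrightarrow> \<exists>y\<in>V. tdist v y = d"
begin

lemma longest_path:
  obtains p where "nb p" "length p = Suc d" "hd p \<in> V"
proof -
  obtain u v where uv: "u \<in> V" "v \<in> V" "tdist u v = d" using diameter_attained by blast
  obtain xs where "nb (u # xs)" "tdist u v = length xs" using ex_nb_Cons[OF uv(1,2)] by blast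
  then show thesis using that[of "u # xs"] uv by simp
qed

lemma ex_center_vertex:
  assumes dh: "d = 2 * Suc h"
  obtains w where "w \<in> V" "card (nbrs w) = k + 1" "\<And>b. b \<in> nbrs w \<Longrightarrow> regular_branch k h w b"
proof -
  obtain p where p: "nb p" "length p = Suc d" "hd p \<in> V" by (rule longest_path)
  \<comment> \<open>The walk has 2 h + 3 vertices: h on either side of the middle three a, w,
    b.\<close>
  from p dh have "length p = h + (h + 3)" by simp
  then obtain xs r where xr: "p = xs @ r" "length xs = h" "length r = h + 3"
    by (rule length_split)
  then obtain a w b ys where "r = a # w # b # ys" "length ys = h"
    by (auto simp: length_Suc_conv numeral_3_eq_3)
  with xr have pe: "p = xs @ a # w # b # ys" by simp
  have wV: "w \<in> V" using nb_set[OF p(1,3)] pe by auto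
  have right: "nb (w # b # ys)" "nb (a # w # b # ys)"
    using p(1) nb_walk_appendD2[of E "xs @ [a]" "w # b # ys"] nb_walk_appendD2[of E xs "a # w # b # ys"]
    by (simp_all add: pe)
  then have "a \<noteq> b" by auto
  have "nb (xs @ [a, w])" using p(1) nb_walk_appendD1[of E "xs @ [a, w]" "b # ys"] by (simp add: pe)
  from nb_rev[OF this] have left: "nb (w # a # rev xs)" by simp
  define y where "y = last (b # ys)"
  have y: "y \<in> branch w b" "tdist w y = Suc h"
    using branchI[OF right(1)] tdist_walk[OF right(1)] \<open>length ys = h\<close> by (auto simp: y_def)
  define z where "z = last (a # rev xs)"
  have z: "z \<in> branch w a" "tdist w z = Suc h"
    using branchI[OF left] tdist_walk[OF left] \<open>length xs = h\<close> by (auto simp: z_def)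
  \<comment> \<open>At least one of the ends \<open>y\<close> and \<open>z\<close> lies outside the
    branch of \<open>x\<close>, so its distance to \<open>x\<close> is
    \<open>tdist w x + Suc h\<close>, which is at most d.\<close>
  have le: "tdist w x \<le> Suc h" if x: "x \<in> V" for x
  proof -
    consider "x = w" | c where "x \<in> branch w c" "c \<in> nbrs w" using V_vertex_decomp[OF wV] x by auto
    then show ?thesis
    proof cases
      case 2
      show ?thesis
      proof (cases "c = b")
        case True
        then have "tdist x z = tdist w x + tdist w z"
          using tdist_between_branches[OF 2(1) z(1)] \<open>a \<noteq> b\<close> by simp
        then show ?thesis using tdist_le[of x z] x z branch_subset dh by fastforce
      next
        case False
        then have "tdist x y = tdist w x + tdist w y"
          using tdist_between_branches[OF 2(1) y(1)] by simp
        then show ?thesis using tdist_le[of x y] x y branch_subset dh by fastforce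
      qed
    qed (simp add: tdist_self)
  qed
  \<comment> \<open>A leaf at depth below \<open>Suc h\<close> would have all vertices within less
    than 2 (h + 1) = d of it, against its eccentricity d.\<close>
  have inner: "card (nbrs x) = k + 1" if x: "x \<in> V" "tdist w x < Suc h" for x
  proof (rule inner_degree[OF x(1)], rule notI)
    assume "card (nbrs x) = 1"
    then obtain y where y: "y \<in> V" "tdist x y = d" using leaf_eccentricity x by blast
    then have "d \<le> tdist w x + tdist w y"
      using tdist_triangle[OF x(1) wV y(1)] tdist_commute[OF x(1) wV] by simp
    then show False using le[OF y(1)] x dh by simp
  qed
  show thesis
  proof (rule that[OF wV])
    show "card (nbrs w) = k + 1" using inner[OF wV] tdist_self by simp
    fix b assume "b \<in> nbrs w"
    moreover have "tdist b x \<le> h \<and> (tdist b x < h \<longrightarrow> card (nbrs x) = k + 1)"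
      if x: "x \<in> branch w b" for x
    proof -
      have "x \<in> V" using x branch_subset by blast
      moreover have "tdist w x = Suc (tdist b x)" using branchE[OF x] by metis
      ultimately show ?thesis using le[of x] inner[of x] by simp
    qed
    ultimately show "regular_branch k h w b" by (simp add: regular_branch_def nbrs_def)
  qed
qed

text \<open>From a vertex at depth less than h, the other side is within (h - 1) + 1 + h and the own
  side within (h - 1) + h. Both are below d, so such a vertex is not a leaf.\<close>

lemma regular_branch_of_edge:
  assumes dh: "d = 2 * h + 1" and ab: "E a b"
    and lea: "\<And>x. x \<in> branch b a \<Longrightarrow> tdist a x \<le> h"
    and leb: "\<And>x. x \<in> branch a b \<Longrightarrow> tdist b x \<le> h"
  shows "regular_branch k h a b"
  unfolding regular_branch_def
proof (intro conjI ballI impI)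
  fix x assume x: "x \<in> branch a b"
  then have xV: "x \<in> V" using branch_subset by blast
  show "tdist b x \<le> h" using leb[OF x] .
  assume lt: "tdist b x < h"
  show "card (nbrs x) = k + 1"
  proof (rule inner_degree[OF xV], rule notI)
    assume "card (nbrs x) = 1"
    then obtain y where y: "y \<in> V" "tdist x y = d" using leaf_eccentricity xV by blast
    then consider "y \<in> branch b a" | "y \<in> branch a b" using V_edge_decomp[OF ab] by blast
    then show False
    proof cases
      case 1
      then show False using tdist_across_edge[OF x 1] lea[OF 1] lt y dh by simp
    next
      case 2
      have "tdist x y \<le> tdist x b + tdist b y"
        using tdist_triangle[OF xV E_in_V2[OF ab] y(1)] .
      then show False using tdist_commute[OF xV E_in_V2[OF ab]] leb[OF 2] lt y dh by simp
    qed
  qed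
qed (rule ab)

lemma ex_center_edge:
  assumes dh: "d = 2 * h + 1"
  obtains a b where "E a b" "regular_branch k h a b" "regular_branch k h b a"
proof -
  obtain p where p: "nb p" "length p = Suc d" "hd p \<in> V" by (rule longest_path)
  from p dh have "length p = h + (h + 2)" by simp
  then obtain xs r where xr: "p = xs @ r" "length xs = h" "length r = h + 2"
    by (rule length_split)
  then obtain a b ys where "r = a # b # ys" "length ys = h"
    by (auto simp: length_Suc_conv numeral_2_eq_2)
  with xr have pe: "p = xs @ a # b # ys" by simp
  have right: "nb (a # b # ys)" using p(1) nb_walk_appendD2[of E xs "a # b # ys"] by (simp add: pe)
  have "nb (xs @ [a, b])" using p(1) nb_walk_appendD1[of E "xs @ [a, b]" ys] by (cases ys) (simp_all add: pe)
  from nb_rev[OF this] have left: "nb (b # a # rev xs)" by simp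
  have ab: "E a b" using right by (rule nb_walk_edge)
  define y where "y = last (b # ys)"
  have y: "y \<in> branch a b" "tdist b y = h"
    using branchI[OF right] tdist_walk[of b ys] nb_walk_ConsD[OF right] \<open>length ys = h\<close>
    by (auto simp: y_def)
  define z where "z = last (a # rev xs)"
  have z: "z \<in> branch b a" "tdist a z = h"
    using branchI[OF left] tdist_walk[of a "rev xs"] nb_walk_ConsD[OF left] \<open>length xs = h\<close>
    by (auto simp: z_def)
  \<comment> \<open>The end \<open>y\<close> across the edge has distance
    \<open>tdist a x + h + 1\<close> from \<open>x\<close>, which is at most 2 h + 1.\<close>
  have lea: "tdist a x \<le> h" if "x \<in> branch b a" for x
    using tdist_across_edge[OF that y(1)] tdist_le[of x y] that y branch_subset dh by fastforce
  have leb: "tdist b x \<le> h" if "x \<in> branch a b" for x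
    using tdist_across_edge[OF that z(1)] tdist_le[of x z] that z branch_subset dh by fastforce
  show thesis
    using that[OF ab regular_branch_of_edge[OF dh ab lea leb] regular_branch_of_edge[OF dh E_sym[OF ab] leb lea]]
    by simp
qed

section \<open>The optimal span\<close>

definition coloring :: "('a \<Rightarrow> nat) \<Rightarrow> bool" where
  "coloring c \<longleftrightarrow> (\<forall>u\<in>V. \<forall>v\<in>V. u \<noteq> v \<longrightarrow>
     int (tdist u v) + \<bar>int (c u) - int (c v)\<bar> \<ge> int (card V) - 1)"

definition optimal_span :: "int \<Rightarrow> bool" where
  "optimal_span s \<longleftrightarrow> (\<forall>c. coloring c \<longrightarrow> s \<le> int (Max (c ` V))) \<and>
     (\<exists>c. coloring c \<and> int (Max (c ` V)) = s)"

text \<open>The lower bound and the construction meet when the order makes the estimate by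
  \<open>l\<close> tight at every step and its ends give the least value possible for distinct
  vertices, 1.\<close>

lemma optimal_spanI:
  assumes u: "bij_betw u {..<card V} V" and small: "2 * d \<le> card V"
    and le: "\<And>u v. u \<in> V \<Longrightarrow> v \<in> V \<Longrightarrow> tdist u v \<le> l u + l v + \<delta>"
    and step: "\<And>i. Suc i < card V \<Longrightarrow> tdist (u i) (u (Suc i)) = l (u i) + l (u (Suc i)) + \<delta>"
    and ends: "l (u 0) + l (u (card V - 1)) + \<delta> = 1"
  shows "optimal_span
    ((int (card V) - 1) * (int (card V) - 1 - int \<delta>) - 2 * int (sum l V) + 1 - int \<delta>)"
proof -
  have card: "card V \<ge> 2" using small d by simp
  show ?thesis
    unfolding optimal_span_def
  proof (intro conjI allI impI)
    fix c assume c: "coloring c"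
    show "(int (card V) - 1) * (int (card V) - 1 - int \<delta>) - 2 * int (sum l V) + 1 - int \<delta>
        \<le> int (Max (c ` V))"
      by (rule coloring_max_ge[where D = tdist, OF finite_V card tdist_pos])
        (use c le in \<open>auto simp: coloring_def\<close>)
  next
    obtain c where "\<And>u v. u \<in> V \<Longrightarrow> v \<in> V \<Longrightarrow> u \<noteq> v \<Longrightarrow>
        int (tdist u v) + \<bar>int (c u) - int (c v)\<bar> \<ge> int (card V) - 1"
      and "int (Max (c ` V)) =
        (int (card V) - 1) * (int (card V) - 1 - int \<delta>) - 2 * int (sum l V) + 1 - int \<delta>"
      by (rule ex_coloring_max_eq[where D = tdist, OF u card small tdist_commute tdist_pos tdist_le step ends])
        auto
    then show "\<exists>c. coloring c \<and> int (Max (c ` V)) =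
        (int (card V) - 1) * (int (card V) - 1 - int \<delta>) - 2 * int (sum l V) + 1 - int \<delta>"
      unfolding coloring_def by blast
  qed
qed

text \<open>Here \<delta> = 0, \<open>l\<close> is the distance from the centre \<open>w\<close>,
  and n - 1 is the size of the k + 1 equal branches.\<close>

lemma optimal_span_even:
  assumes dh: "d = 2 * Suc h"
  shows "optimal_span (int ((k + 1) * (\<Sum>i\<le>h. k ^ i)) ^ 2
    - 2 * int ((k + 1) * (\<Sum>i\<le>h. (i + 1) * k ^ i)) + 1)"
proof -
  obtain w where w: "w \<in> V" "card (nbrs w) = k + 1"
    and reg: "\<And>b. b \<in> nbrs w \<Longrightarrow> regular_branch k h w b"
    by (rule ex_center_vertex[OF dh]) blast
  note br = regular_branch_card_sum[OF reg]
  define m where "m = (\<Sum>i\<le>h. k ^ i)"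
  let ?W = "\<Union>b\<in>nbrs w. branch w b"
  have notin: "w \<notin> ?W" using start_notin_branch by auto
  have finW: "finite ?W" using finite_nbrs finite_branch by auto
  have "card ?W = (\<Sum>b\<in>nbrs w. card (branch w b))"
    using finite_nbrs finite_branch branch_disjoint by (intro card_UN_disjoint) auto
  also have "\<dots> = (k + 1) * m" using br w by (simp add: m_def)
  finally have cardW: "card ?W = (k + 1) * m" .
  have V: "V = insert w ?W" by (rule V_vertex_decomp[OF w(1)])
  have cardV: "card V = Suc ((k + 1) * m)"
    by (subst V) (use notin finW cardW in simp)
  have "(\<Sum>x\<in>V. tdist w x) = (\<Sum>x\<in>?W. tdist w x)"
    by (subst V) (use notin finW tdist_self in simp)
  also have "\<dots> = (\<Sum>b\<in>nbrs w. \<Sum>x\<in>branch w b. tdist w x)"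
    using finite_nbrs finite_branch branch_disjoint by (intro sum.UNION_disjoint) auto
  also have "\<dots> = (k + 1) * (\<Sum>i\<le>h. (i + 1) * k ^ i)" using br w by simp
  finally have sumV: "(\<Sum>x\<in>V. tdist w x) = (k + 1) * (\<Sum>i\<le>h. (i + 1) * k ^ i)" .
  have m: "m \<ge> 2 * h + 1" unfolding m_def by (rule geometric_ge[OF k])
  obtain f where f: "bij_betw f {..<k + 1} (nbrs w)"
    using ex_bij_betw_nat_finite[OF finite_nbrs, of w] w by (auto simp: atLeast0LessThan)
  have fin: "f i \<in> nbrs w" if "i < k + 1" for i using f that by (auto simp: bij_betw_def)
  have root: "f i \<in> branch w (f i)" if "i < k + 1" for i
    using root_in_branch fin[OF that] by (simp add: nbrs_def)
  \<comment> \<open>The last vertex is a neighbour of \<open>w\<close>; with \<open>w\<close> placed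
    in front, the ends contribute 0 + 1. The prescribed first vertex \<open>f 0\<close> is an
    arbitrary choice.\<close>
  obtain u where u: "bij_betw u {..<(k + 1) * m} (\<Union>b<k + 1. branch w (f b))"
      "u ((k + 1) * m - 1) = f k"
    and alt: "\<And>q. Suc q < (k + 1) * m \<Longrightarrow>
      \<exists>a<k + 1. \<exists>b<k + 1. a \<noteq> b \<and> u q \<in> branch w (f a) \<and> u (Suc q) \<in> branch w (f b)"
  proof (rule ex_round_robin[of "k + 1" m "\<lambda>i. branch w (f i)" "f 0" "f k"])
    show "branch w (f a) \<inter> branch w (f b) = {}" if "a < k + 1" "b < k + 1" "a \<noteq> b" for a b
      using f that by (intro branch_disjoint) (auto simp: bij_betw_def inj_on_def)
  qed (use k m finite_branch br fin root in \<open>auto simp: m_def\<close>)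
  have "(\<Union>b<k + 1. branch w (f b)) = \<Union> (branch w ` f ` {..<k + 1})" by (simp only: image_image)
  then have "(\<Union>b<k + 1. branch w (f b)) = ?W" using f by (simp only: bij_betw_def)
  then have bij: "bij_betw (case_nat w u) {..<card V} V"
    using bij_betw_case_nat[OF u(1)] notin V cardV by simp
  have "optimal_span ((int (card V) - 1) * (int (card V) - 1 - int 0) - 2 * int (sum (tdist w) V) + 1 - int 0)"
  proof (rule optimal_spanI[OF bij])
    \<comment> \<open>By \<open>m\<close>, 3 m + 1 \<ge> 6 h + 4 \<ge> 4 h + 4 = 2 d; equality
      occurs for the star with h = 0.\<close>
    have "2 * d \<le> 3 * m + 1" using m dh by simp
    also have "\<dots> \<le> (k + 1) * m + 1" using k by simp
    finally show "2 * d \<le> card V" using cardV by simp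
    show "tdist x y \<le> tdist w x + tdist w y + 0" if "x \<in> V" "y \<in> V" for x y
      using tdist_triangle[OF that(1) w(1) that(2)] tdist_commute[OF w(1) that(1)] by simp
    show "tdist (case_nat w u i) (case_nat w u (Suc i)) =
        tdist w (case_nat w u i) + tdist w (case_nat w u (Suc i)) + 0" if "Suc i < card V" for i
    proof (cases i)
      case 0
      then show ?thesis by (simp add: tdist_self)
    next
      case (Suc j)
      then have "Suc j < (k + 1) * m" using that cardV by simp
      then obtain a b where ab: "a < k + 1" "b < k + 1" "a \<noteq> b"
        "u j \<in> branch w (f a)" "u (Suc j) \<in> branch w (f b)" using alt by blast
      then have "f a \<noteq> f b" using f by (auto simp: bij_betw_def inj_on_def)
      then show ?thesis using tdist_between_branches ab Suc by simp
    qed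
    have "E w (f k)" using fin[of k] by (simp add: nbrs_def)
    then have "tdist w (f k) = 1" using tdist_walk[of w "[f k]"] by simp
    moreover have "(k + 1) * m = Suc ((k + 1) * m - 1)" using m by simp
    ultimately show "tdist w (case_nat w u 0) + tdist w (case_nat w u (card V - 1)) + 0 = 1"
      using u(2) cardV tdist_self by (metis add_0 add_0_right diff_Suc_1 old.nat.simps(4,5))
  qed
  then show ?thesis using cardV sumV unfolding m_def by (simp add: power2_eq_square)
qed

text \<open>Here \<delta> = 1 and the two halves at the central edge, of size m each, alternate. The
  order starts in \<open>a\<close> and ends in \<open>b\<close>, where \<open>l\<close> vanishes, so
  the ends condition reduces to \<delta> = 1.\<close>

lemma optimal_span_odd:
  assumes dh: "d = 2 * h + 1"
  shows "optimal_span ((2 * int (\<Sum>i\<le>h. k ^ i) - 1) * (2 * int (\<Sum>i\<le>h. k ^ i) - 2)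
    - 4 * int (\<Sum>i\<le>h. i * k ^ i))"
proof -
  obtain a b where ab: "E a b" and reg: "regular_branch k h a b" "regular_branch k h b a"
    by (rule ex_center_edge[OF dh])
  define m where "m = (\<Sum>i\<le>h. k ^ i)"
  note br = regular_branch_card_sum[OF reg(1)] regular_branch_card_sum[OF reg(2)]
  note disj = opposite_branch_disjoint[of b a]
  have V: "V = branch b a \<union> branch a b" using V_edge_decomp[OF ab] by blast
  have aV: "a \<in> V" and bV: "b \<in> V" using ab E_in_V E_in_V2 by auto
  define l where "l x = (if x \<in> branch b a then tdist a x else tdist b x)" for x
  have la: "l x = tdist a x" if "x \<in> branch b a" for x using that by (simp add: l_def)
  have lb: "l x = tdist b x" if "x \<in> branch a b" for x using that disj by (auto simp: l_def)
  have cardV: "card V = 2 * m"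
    unfolding V using br disj finite_branch by (simp add: card_Un_disjoint m_def)
  \<comment> \<open>The known sum is measured from the far end of the central edge; one unit per
    vertex is taken off.\<close>
  have sub: "sum (tdist y) (branch x y) = (\<Sum>i\<le>h. i * k ^ i)"
    if "regular_branch k h x y" for x y
  proof -
    have "(\<Sum>z\<in>branch x y. tdist x z) = (\<Sum>z\<in>branch x y. tdist y z) + card (branch x y)"
    proof -
      have "(\<Sum>z\<in>branch x y. tdist x z) = (\<Sum>z\<in>branch x y. Suc (tdist y z))"
        by (rule sum.cong) (auto elim!: branchE)
      then show ?thesis by (simp add: sum_Suc)
    qed
    then show ?thesis using regular_branch_card_sum[OF that] by (simp add: sum.distrib)
  qed
  have "sum l V = sum l (branch b a) + sum l (branch a b)"
    unfolding V using disj finite_branch by (intro sum.union_disjoint)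
  also have "\<dots> = 2 * (\<Sum>i\<le>h. i * k ^ i)"
    using sub[OF reg(1)] sub[OF reg(2)] la lb by simp
  finally have sumV: "sum l V = 2 * (\<Sum>i\<le>h. i * k ^ i)" .
  have m: "m \<ge> 2 * h + 1" unfolding m_def by (rule geometric_ge[OF k])
  define B where "B i = (if i = 0 then branch b a else branch a b)" for i :: nat
  obtain u where u: "bij_betw u {..<2 * m} (\<Union>i<2. B i)" "u 0 = a" "u (2 * m - 1) = b"
    and alt: "\<And>q. Suc q < 2 * m \<Longrightarrow>
      \<exists>i<2. \<exists>j<2. i \<noteq> j \<and> u q \<in> B i \<and> u (Suc q) \<in> B j"
    by (rule ex_round_robin[of 2 m B a b])
      (use m br finite_branch disj root_in_branch[OF ab] root_in_branch[OF E_sym[OF ab]]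
        in \<open>auto simp: B_def m_def split: if_splits\<close>)
  have "{..<2} = {0, 1 :: nat}" by auto
  then have "(\<Union>i<2. B i) = V" unfolding V by (simp add: B_def Un_commute)
  with u have bij: "bij_betw u {..<card V} V" using cardV by simp
  have "optimal_span ((int (card V) - 1) * (int (card V) - 1 - int 1) - 2 * int (sum l V) + 1 - int 1)"
  proof (rule optimal_spanI[OF bij])
    \<comment> \<open>This is 4 h + 2 \<le> 2 m, exactly twice the bound on m.\<close>
    show "2 * d \<le> card V" using m dh cardV by simp
    have tri: "tdist x y \<le> tdist z x + tdist z y" if "x \<in> V" "y \<in> V" "z \<in> V" for x y z
      using tdist_triangle[OF that(1) that(3) that(2)] tdist_commute[OF that(3) that(1)] by simp
    show "tdist x y \<le> l x + l y + 1" if xy: "x \<in> V" "y \<in> V" for x y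
    proof -
      consider "x \<in> branch b a" "y \<in> branch b a" | "x \<in> branch b a" "y \<in> branch a b"
        | "x \<in> branch a b" "y \<in> branch b a" | "x \<in> branch a b" "y \<in> branch a b"
        using xy V by blast
      then show ?thesis
        using tri[OF xy aV] tri[OF xy bV] tdist_across_edge[of x b a y] tdist_across_edge[of x a b y] la lb
        by cases auto
    qed
    show "tdist (u i) (u (Suc i)) = l (u i) + l (u (Suc i)) + 1" if "Suc i < card V" for i
    proof -
      from that obtain p q where "p < 2" "q < 2" "p \<noteq> q" "u i \<in> B p" "u (Suc i) \<in> B q"
        using alt cardV by metis
      then consider "u i \<in> branch b a" "u (Suc i) \<in> branch a b"
        | "u i \<in> branch a b" "u (Suc i) \<in> branch b a"
        by (auto simp: B_def split: if_splits)
      then show ?thesis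
        using tdist_across_edge[of "u i" b a "u (Suc i)"] tdist_across_edge[of "u i" a b "u (Suc i)"] la lb
        by cases auto
    qed
    show "l (u 0) + l (u (card V - 1)) + 1 = 1"
      using u cardV la lb root_in_branch[OF ab] root_in_branch[OF E_sym[OF ab]] tdist_self by simp
  qed
  then show ?thesis using cardV sumV unfolding m_def by (simp add: algebra_simps)
qed

end

section \<open>From digraphs to vertex lists\<close>

context wf_digraph
begin

lemma successively_awalk_verts:
  "awalk u p v \<Longrightarrow> successively (\<lambda>x y. (x, y) \<in> arcs_ends G) (awalk_verts u p)"
proof (induction p arbitrary: u)
  case (Cons e es)
  then have "awalk (head G e) es v" "e \<in> arcs G" by (auto simp: awalk_Cons_iff)
  with Cons.IH show ?case
    by (simp add: successively_Cons in_arcs_imp_in_arcs_ends)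
qed simp

lemma ex_awalk_of_vertices:
  assumes "successively (\<lambda>x y. (x, y) \<in> arcs_ends G) (x # xs)" "x \<in> verts G"
  shows "\<exists>p. awalk x p (last (x # xs)) \<and> awalk_verts x p = x # xs"
  using assms
proof (induction xs arbitrary: x)
  case Nil
  then show ?case by (intro exI[of _ "[]"]) (simp add: awalk_Nil_iff)
next
  case (Cons y ys)
  then obtain e where e: "e \<in> arcs G" "tail G e = x" "head G e = y" by auto
  then have "y \<in> verts G" by auto
  with Cons obtain p where "awalk y p (last (y # ys))" "awalk_verts y p = y # ys" by auto
  with e show ?case by (intro exI[of _ "e # p"]) (simp add: awalk_Cons_iff)
qed

text \<open>Repeating the first vertex at the end yields a closed walk with as many arcs as
  \<open>xs\<close> has vertices, so the bound 3 carries over.\<close>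

lemma ex_long_cycle:
  assumes "distinct xs" "3 \<le> length xs" "successively (\<lambda>x y. (x, y) \<in> arcs_ends G) xs"
    and "(last xs, hd xs) \<in> arcs_ends G"
  shows "\<exists>p. cycle p \<and> 3 \<le> length p"
proof -
  obtain x ys where xs: "xs = x # ys" using assms(2) by (cases xs) auto
  have "successively (\<lambda>x y. (x, y) \<in> arcs_ends G) (xs @ [x])"
    using assms xs by (subst successively_append_iff) auto
  moreover have "x \<in> verts G" using assms(4) xs by auto
  ultimately obtain p where p: "awalk x p (last (x # ys @ [x]))" "awalk_verts x p = x # ys @ [x]"
    using ex_awalk_of_vertices[of x "ys @ [x]"] xs by auto
  have "length p = length xs" using length_awalk_verts[of x p] p xs by simp
  moreover have "cycle p"
    unfolding cycle_def using p assms xs calculation by (intro exI[of _ x]) auto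
  ultimately show ?thesis using assms by auto
qed

end

lemma vertex_tree_of_undirected_tree:
  assumes "undirected_tree G"
  shows "vertex_tree (verts G) (\<lambda>u v. (u, v) \<in> arcs_ends G)"
proof -
  from assms interpret graph G by (simp add: undirected_tree_def)
  show ?thesis
  proof
    show "finite (verts G)" by simp
    show "u \<in> verts G" if "(u, v) \<in> arcs_ends G" for u v using that by auto
    show "(v, u) \<in> arcs_ends G" if "(u, v) \<in> arcs_ends G" for u v
      using sym_arcs that by (rule arcs_ends_symmetric)
    show "(u, u) \<notin> arcs_ends G" for u using adj_not_same by blast
    show "(\<lambda>u v. (u, v) \<in> arcs_ends G)\<^sup>*\<^sup>* u v" if "u \<in> verts G" "v \<in> verts G" for u v
    proof -
      \<comment> \<open>Connectedness refers to the symmetric closure, in which reachability is the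
        same because the arcs are already symmetric.\<close>
      have "u \<rightarrow>\<^sup>*\<^bsub>G\<^esub> v"
        using assms that reachable_mk_symmetric_eq[OF sym_arcs]
        by (auto simp: undirected_tree_def Digraph_Component.connected_def strongly_connected_def)
      then show ?thesis
        by (induction rule: reachable_induct) (auto intro: rtranclp.rtrancl_into_rtrancl)
    qed
    show "(last xs, hd xs) \<notin> arcs_ends G"
      if "distinct xs" "3 \<le> length xs" "successively (\<lambda>u v. (u, v) \<in> arcs_ends G) xs" for xs
      using that assms ex_long_cycle by (auto simp: undirected_tree_def)
  qed
qed

locale undirected_tree_graph = graph G for G :: "('a, 'b) pre_digraph" +
  assumes tree: "undirected_tree G"
begin

sublocale T: vertex_tree "verts G" "\<lambda>u v. (u, v) \<in> arcs_ends G"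
  using tree by (rule vertex_tree_of_undirected_tree)

text \<open>Every path is a non-backtracking walk, and these are unique. As the set is a singleton,
  its maximum and minimum agree, which identifies detour distance and distance.\<close>

lemma apath_lengths:
  assumes "u \<in> verts G" "v \<in> verts G"
  shows "{length p | p. apath u p v} = {T.tdist u v}"
proof -
  have len: "length p = T.tdist u v" if "apath u p v" for p
  proof -
    have p: "awalk u p v" "distinct (awalk_verts u p)" using that by (auto simp: apath_def)
    then have "T.nb (awalk_verts u p)"
      using successively_awalk_verts by (intro T.distinct_nb) auto
    then show ?thesis using T.tdist_eq p by (simp add: length_awalk_verts)
  qed
  obtain xs where xs: "T.nb (u # xs)" "last (u # xs) = v" using T.ex_nb_Cons[OF assms] by blast
  obtain p where "awalk u p v" "awalk_verts u p = u # xs"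
    using ex_awalk_of_vertices[OF nb_walk_successively[OF xs(1)] assms(1)] xs(2) by auto
  then have "apath u p v" using T.nb_distinct[OF xs(1)] by (simp add: apath_def)
  then show ?thesis using len by force
qed

lemma detour_distance_eq: "u \<in> verts G \<Longrightarrow> v \<in> verts G \<Longrightarrow> detour_distance G u v = T.tdist u v"
  using apath_lengths by (simp add: detour_distance_def)

lemma graph_distance_eq: "u \<in> verts G \<Longrightarrow> v \<in> verts G \<Longrightarrow> graph_distance G u v = T.tdist u v"
  using apath_lengths by (simp add: graph_distance_def)

lemma out_degree_eq: "out_degree G v = card (T.nbrs v)"
proof -
  have "T.nbrs v = head G ` out_arcs G v"
    unfolding T.nbrs_def by (auto simp: arcs_ends_conv image_iff)
  moreover have "inj_on (head G) (out_arcs G v)"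
    using no_multi_arcs by (auto simp: inj_on_def arc_to_ends_def)
  ultimately show ?thesis by (simp add: out_degree_def card_image)
qed

lemma verts_nonempty: "verts G \<noteq> {}"
  using tree by (auto simp: undirected_tree_def Digraph_Component.connected_def strongly_connected_def)

lemma eccentricity_eq: "u \<in> verts G \<Longrightarrow> eccentricity G u = Max (T.tdist u ` verts G)"
  unfolding eccentricity_def using graph_distance_eq by (metis (no_types, lifting) image_cong)

lemma tdist_le_eccentricity: "u \<in> verts G \<Longrightarrow> v \<in> verts G \<Longrightarrow> T.tdist u v \<le> eccentricity G u"
  by (simp add: eccentricity_eq)

lemma eccentricity_attained:
  assumes "u \<in> verts G"
  obtains v where "v \<in> verts G" "T.tdist u v = eccentricity G u"
proof -
  have "eccentricity G u \<in> T.tdist u ` verts G"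
    unfolding eccentricity_eq[OF assms] using verts_nonempty by (intro Max_in) auto
  then show thesis using that by auto
qed

lemma eccentricity_le_diameter: "u \<in> verts G \<Longrightarrow> eccentricity G u \<le> diameter G"
  by (simp add: diameter_def)

lemma diameter_attained:
  obtains u where "u \<in> verts G" "eccentricity G u = diameter G"
proof -
  have "diameter G \<in> eccentricity G ` verts G"
    unfolding diameter_def using verts_nonempty by (intro Max_in) auto
  then show thesis using that by auto
qed

lemma leaf_regular:
  assumes sym: "is_symmetric_tree (k + 1) d G" and "k \<ge> 2" "d \<ge> 2"
  shows "leaf_regular_tree (verts G) (\<lambda>u v. (u, v) \<in> arcs_ends G) k d"
proof
  have diam: "diameter G = d" using sym by (simp add: is_symmetric_tree_def)
  have leaf: "leaf G v \<longleftrightarrow> v \<in> verts G \<and> card (T.nbrs v) = 1" for v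
    by (simp add: leaf_def out_degree_eq)
  show le: "T.tdist u v \<le> d" if "u \<in> verts G" "v \<in> verts G" for u v
    using tdist_le_eccentricity[OF that] eccentricity_le_diameter[OF that(1)] diam by simp
  obtain u where u: "u \<in> verts G" "eccentricity G u = d" using diameter_attained diam by blast
  obtain v where v: "v \<in> verts G" "T.tdist u v = d" using eccentricity_attained[OF u(1)] u(2) by metis
  show "\<exists>u\<in>verts G. \<exists>v\<in>verts G. T.tdist u v = d" using u v by blast
  show "card (T.nbrs v) = k + 1" if "v \<in> verts G" "card (T.nbrs v) \<noteq> 1" for v
    using sym that leaf by (auto simp: is_symmetric_tree_def out_degree_eq)
  \<comment> \<open>The end \<open>u\<close> of a longest path is a leaf of eccentricity d, so the
    symmetry condition passes this value on to all leaves.\<close>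
  have "leaf G u"
    unfolding leaf using T.end_of_longest_path_card_nbrs[OF u(1) v(1,2) _ le] u(1) assms(3) by simp
  show "\<exists>y\<in>verts G. T.tdist x y = d" if "x \<in> verts G" "card (T.nbrs x) = 1" for x
  proof -
    have "leaf G x" unfolding leaf using that by simp
    with \<open>leaf G u\<close> sym have "eccentricity G x = d"
      unfolding is_symmetric_tree_def symmetric_tree_def using u(2) by metis
    then show ?thesis using eccentricity_attained[OF that(1)] by metis
  qed
qed (use assms in auto)

end

lemma hamiltonian_chromatic_number_eq:
  assumes tree: "undirected_tree_graph G"
    and reg: "leaf_regular_tree (verts G) (\<lambda>u v. (u, v) \<in> arcs_ends G) k d"
    and span: "leaf_regular_tree.optimal_span (verts G) (\<lambda>u v. (u, v) \<in> arcs_ends G) s"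
  shows "int (hamiltonian_chromatic_number G) = s"
proof -
  interpret undirected_tree_graph G by (rule tree)
  interpret R: leaf_regular_tree "verts G" "\<lambda>u v. (u, v) \<in> arcs_ends G" k d by (rule reg)
  have col: "hamiltonian_coloring G c \<longleftrightarrow> R.coloring c" for c
    by (auto simp: hamiltonian_coloring_def R.coloring_def detour_distance_eq)
  obtain c where c: "R.coloring c" "int (Max (c ` verts G)) = s"
    and min: "\<And>c. R.coloring c \<Longrightarrow> s \<le> int (Max (c ` verts G))"
    using span unfolding R.optimal_span_def by blast
  have "hamiltonian_chromatic_number G = Max (c ` verts G)"
    unfolding hamiltonian_chromatic_number_def
  proof (rule Least_equality)
    show "\<exists>c'. hamiltonian_coloring G c' \<and> hc_value G c' = Max (c ` verts G)"
      using c col by (auto simp: hc_value_def)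
    show "Max (c ` verts G) \<le> y" if "\<exists>c'. hamiltonian_coloring G c' \<and> hc_value G c' = y" for y
      using that min col c(2) by (auto simp: hc_value_def)
  qed
  then show ?thesis using c by simp
qed

section \<open>Closed forms\<close>

text \<open>Stated without denominators, the induction step is a polynomial identity.\<close>

lemma sum_arith_geometric:
  fixes k :: real
  shows "(k - 1)\<^sup>2 * (\<Sum>i\<le>h. real i * k ^ i) = (real h * k\<^sup>2 - (real h + 1) * k) * k ^ h + k"
proof (induction h)
  case (Suc h)
  have "(k - 1)\<^sup>2 * (\<Sum>i\<le>Suc h. real i * k ^ i) =
    (real h * k\<^sup>2 - (real h + 1) * k) * k ^ h + k + (k - 1)\<^sup>2 * ((real h + 1) * (k * k ^ h))"
    using Suc by (simp add: distrib_left)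
  also have "\<dots> = (real (Suc h) * k\<^sup>2 - (real (Suc h) + 1) * k) * k ^ Suc h + k"
    by (simp add: power2_eq_square algebra_simps)
  finally show ?case .
qed simp

lemma sum_geometric:
  fixes k :: real
  shows "(k - 1) * (\<Sum>i\<le>h. k ^ i) = k * k ^ h - 1"
  by (induction h) (auto simp: algebra_simps)

lemma even_closed_form:
  fixes k :: nat
  assumes "k \<ge> 2"
  shows "real_of_int (int ((k + 1) * (\<Sum>i\<le>h. k ^ i)) ^ 2 - 2 * int ((k + 1) * (\<Sum>i\<le>h. (i + 1) * k ^ i)) + 1)
    = (real k + 1)^2 / (real k - 1)^2 * (real k ^ Suc h - 1) *
        ((real k ^ Suc h - 1) + 1 / (real k + 1) * (2 - (real k - 1) * real (2 * Suc h)))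
      - (real k + 1) / (real k - 1) * real (2 * Suc h) + 1"
proof -
  \<comment> \<open>With d = 2 (h + 1), the power \<open>k^(d/2)\<close> of the formula is x *
    K.\<close>
  define x K S A where "x = real k" "K = x ^ h" "S = (\<Sum>i\<le>h. x ^ i)" "A = (\<Sum>i\<le>h. real i * x ^ i)"
  have x: "x - 1 \<noteq> 0" "x + 1 \<noteq> 0" using assms by (auto simp: x_K_S_A_def)
  have S: "S = (x * K - 1) / (x - 1)"
    using sum_geometric[of x h] x by (simp add: x_K_S_A_def field_simps)
  have A: "A = ((real h * x\<^sup>2 - (real h + 1) * x) * K + x) / (x - 1)\<^sup>2"
    using sum_arith_geometric[of x h] x unfolding x_K_S_A_def by (subst eq_divide_eq) (simp add: mult.commute)
  have "real (\<Sum>i\<le>h. k ^ i) = S" "real (\<Sum>i\<le>h. (i + 1) * k ^ i) = A + S"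
    by (simp_all add: x_K_S_A_def sum.distrib algebra_simps)
  then have "real_of_int (int ((k + 1) * (\<Sum>i\<le>h. k ^ i)) ^ 2 - 2 * int ((k + 1) * (\<Sum>i\<le>h. (i + 1) * k ^ i)) + 1)
      = ((x + 1) * S)\<^sup>2 - 2 * ((x + 1) * (A + S)) + 1"
    by (simp add: x_K_S_A_def algebra_simps del: of_nat_sum)
  also have "\<dots> = (x + 1)^2 / (x - 1)^2 * (x * K - 1) *
        ((x * K - 1) + 1 / (x + 1) * (2 - (x - 1) * (2 * (real h + 1))))
      - (x + 1) / (x - 1) * (2 * (real h + 1)) + 1"
    unfolding S A using x by (simp add: divide_simps) (simp add: algebra_simps power2_eq_square)
  finally show ?thesis by (simp add: x_K_S_A_def algebra_simps)
qed

lemma odd_closed_form: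
  fixes k :: nat
  assumes "k \<ge> 2"
  shows "real_of_int ((2 * int (\<Sum>i\<le>h. k ^ i) - 1) * (2 * int (\<Sum>i\<le>h. k ^ i) - 2) - 4 * int (\<Sum>i\<le>h. i * k ^ i))
    = 4 * real k / (real k - 1)^2 * (real k ^ h - 1) * (real k * (real k ^ h - 1) + 1)
      + 2 * real k / (real k - 1) * (2 - real (2 * h + 1)) * real k ^ h
      - 2 * real k / (real k - 1)"
proof -
  \<comment> \<open>With d = 2 h + 1, the power \<open>k^((d-1)/2)\<close> of the formula is K
    itself.\<close>
  define x K S A where "x = real k" "K = x ^ h" "S = (\<Sum>i\<le>h. x ^ i)" "A = (\<Sum>i\<le>h. real i * x ^ i)"
  have x: "x - 1 \<noteq> 0" using assms by (auto simp: x_K_S_A_def)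
  have S: "S = (x * K - 1) / (x - 1)"
    using sum_geometric[of x h] x by (simp add: x_K_S_A_def field_simps)
  have A: "A = ((real h * x\<^sup>2 - (real h + 1) * x) * K + x) / (x - 1)\<^sup>2"
    using sum_arith_geometric[of x h] x unfolding x_K_S_A_def by (subst eq_divide_eq) (simp add: mult.commute)
  have "real (\<Sum>i\<le>h. k ^ i) = S" "real (\<Sum>i\<le>h. i * k ^ i) = A"
    by (simp_all add: x_K_S_A_def)
  then have "real_of_int ((2 * int (\<Sum>i\<le>h. k ^ i) - 1) * (2 * int (\<Sum>i\<le>h. k ^ i) - 2) - 4 * int (\<Sum>i\<le>h. i * k ^ i))
      = (2 * S - 1) * (2 * S - 2) - 4 * A"
    by (simp del: of_nat_sum)
  also have "\<dots> = 4 * x / (x - 1)^2 * (K - 1) * (x * (K - 1) + 1)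
      + 2 * x / (x - 1) * (2 - (2 * real h + 1)) * K - 2 * x / (x - 1)"
    unfolding S A using x by (simp add: divide_simps) (simp add: algebra_simps power2_eq_square)
  finally show ?thesis by (simp add: x_K_S_A_def)
qed

theorem theorem6:
  fixes T :: "('a, 'b) pre_digraph" and k d :: nat
  assumes "k \<ge> 2" and "d \<ge> 2"
    and "is_symmetric_tree (k + 1) d T"
  shows "(even d \<longrightarrow>
      real (hamiltonian_chromatic_number T) =
        (real k + 1)^2 / (real k - 1)^2 * (real k ^ (d div 2) - 1) *
          ((real k ^ (d div 2) - 1) + 1 / (real k + 1) * (2 - (real k - 1) * real d))
        - (real k + 1) / (real k - 1) * real d + 1) \<and>
    (odd d \<longrightarrow>
      real (hamiltonian_chromatic_number T) =
        4 * real k / (real k - 1)^2 * (real k ^ ((d - 1) div 2) - 1) *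
          (real k * (real k ^ ((d - 1) div 2) - 1) + 1)
        + 2 * real k / (real k - 1) * (2 - real d) * real k ^ ((d - 1) div 2)
        - 2 * real k / (real k - 1))"
proof -
  have tree: "undirected_tree T"
    using assms(3) by (simp add: is_symmetric_tree_def symmetric_tree_def)
  then have T: "undirected_tree_graph T"
    by (simp add: undirected_tree_graph_def undirected_tree_graph_axioms_def undirected_tree_def)
  note reg = undirected_tree_graph.leaf_regular[OF T assms(3,1,2)]
  have hc: "real (hamiltonian_chromatic_number T) = real_of_int s"
    if "leaf_regular_tree.optimal_span (verts T) (\<lambda>u v. (u, v) \<in> arcs_ends T) s" for s
    using hamiltonian_chromatic_number_eq[OF T reg that] by linarith
  show ?thesis
  proof (intro conjI impI)
    assume "even d"
    \<comment> \<open>Since d \<ge> 2, half of d is a successor; h is the depth of a branch measured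
      from its root, a neighbour of the centre.\<close>
    then obtain h where "d = 2 * Suc h" using assms(2) by (metis dvdE mult_0_right not0_implies_Suc not_numeral_le_zero)
    then show "real (hamiltonian_chromatic_number T) =
        (real k + 1)^2 / (real k - 1)^2 * (real k ^ (d div 2) - 1) *
          ((real k ^ (d div 2) - 1) + 1 / (real k + 1) * (2 - (real k - 1) * real d))
        - (real k + 1) / (real k - 1) * real d + 1"
      using hc[OF leaf_regular_tree.optimal_span_even[OF reg]] even_closed_form[OF assms(1), of h]
      by (simp only: nonzero_mult_div_cancel_left[of 2 "Suc h"] zero_neq_numeral not_False_eq_True)
  next
    assume "odd d"
    then obtain h where "d = 2 * h + 1" by (rule oddE)
    moreover from this have "(d - 1) div 2 = h" by simp
    ultimately show "real (hamiltonian_chromatic_number T) =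
        4 * real k / (real k - 1)^2 * (real k ^ ((d - 1) div 2) - 1) *
          (real k * (real k ^ ((d - 1) div 2) - 1) + 1)
        + 2 * real k / (real k - 1) * (2 - real d) * real k ^ ((d - 1) div 2)
        - 2 * real k / (real k - 1)"
      using hc[OF leaf_regular_tree.optimal_span_odd[OF reg]] odd_closed_form[OF assms(1), of h]
      by (simp only:)
  qed
qed

end
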